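(* Let $(X,Y)$ be a random vector in $\mathbb{R}^{d_x}\times\mathbb{R}^{d_y}$ with law $\nu$ and $\mathbb{E}[X]=0$, let $\mu$ be a Borel probability measure on $\mathbb{R}^{d_y}$, and let $\varepsilon>0$. Suppose that $\mathbb{E}[XX^\top]$ is invertible and that the supports $\mathcal U$ of $\mu$, $\mathcal X$ of (the law of) $X$ and $\mathcal Y$ of (the law of) $Y$ are all compact. Let $(f^\varepsilon,g^\varepsilon,h^\varepsilon)$ be dual potentials, with versions chosen such that for all $u\in\mathbb{R}^{d_y}$ and all $(x,y)\in\mathbb{R}^{d_x+d_y}$: $$f^\varepsilon(u)=-\varepsilon\log\int e^{\frac1\varepsilon(\langle g^\varepsilon(u),x\rangle+h^\varepsilon(x,y)-c(u,y))}\,d\nu(x,y),$$ $$\int x\, e^{\frac1\varepsilon(\langle g^\varepsilon(u),x\rangle+h^\varepsilon(x,y)-c(u,y))}\,d\nu(x,y)=0,$$ $$h^\varepsilon(x,y)=-\varepsilon\log\int e^{\frac1\varepsilon(f^\varepsilon(u)+\langle g^\varepsilon(u),x\rangle-c(u,y))}\,d\mu(u).$$ Then: (i) $f^\varepsilon$ and each coordinate of $g^\varepsilon$ are real analytic functions on $\mathbb{R}^{d_y}$; and (ii) $h^\varepsilon$ is a real analytic function on $\mathbb{R}^{d_x+d_y}$.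
   Context: Points of $\mathbb{R}^{d_y}\times\mathbb{R}^{d_x+d_y}$ are written $(u,x,y)$; $c(u,y):=\frac12\|u-y\|^2$ and $R:=\mu\otimes\nu$. Dual potentials are triples $(f,g,h)\in L^1(\mu)\times L^1(\mu;\mathbb{R}^{d_x})\times L^1(\nu)$ attaining the supremum, over all such triples, of $$D^\varepsilon(f,g,h):=\int f\,d\mu+\int h\,d\nu-\varepsilon\int e^{\frac1\varepsilon(f(u)+\langle g(u),x\rangle+h(x,y)-c(u,y))}\,dR(u,x,y)+\varepsilon.$$ They are characterized by the three displayed equations in the claim holding $\mu$-a.e., $\mu$-a.e. and $\nu$-a.e., respectively; existence of such dual potentials is assumed. Under the stated assumptions, versions (i.e. modifications on $\mu$-null, respectively $\nu$-null, sets) can be chosen so that all three equations hold everywhere, with $g^\varepsilon$ everywhere $\mathbb{R}^{d_x}$-valued. *)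

theory Defs
  imports "HOL-Probability.Probability"
begin

definition measure_support :: "'a::topological_space measure \<Rightarrow> 'a set" where
  "measure_support M = {x. \<forall>U. open U \<longrightarrow> x \<in> U \<longrightarrow> emeasure M U > 0}"

text \<open>Real analyticity on the whole space: near every point the function is the sum of a
  multivariate power series in the coordinates. A multi-index is a function on the canonical
  basis, extended by 0 so that it is unique. \<^const>\<open>has_sum\<close> is unconditional,
  hence for real-valued terms absolute, convergence.\<close>

definition multi_indices :: "('a::euclidean_space \<Rightarrow> nat) set" where
  "multi_indices = {\<alpha>. \<forall>b. b \<notin> Basis \<longrightarrow> \<alpha> b = 0}"

definition real_analytic :: "('a::euclidean_space \<Rightarrow> real) \<Rightarrow> bool" where
  "real_analytic f \<longleftrightarrow>
     (\<forall>a. \<exists>r>0. \<exists>C. \<forall>z\<in>ball a r.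
        ((\<lambda>\<alpha>. C \<alpha> * (\<Prod>b\<in>Basis. ((z - a) \<bullet> b) ^ \<alpha> b)) has_sum f z) multi_indices)"

definition cost :: "real ^ 'dy \<Rightarrow> real ^ 'dy \<Rightarrow> real" where
  "cost u y = (norm (u - y))\<^sup>2 / 2"

text \<open>The exponential integral is taken in \<^typ>\<open>ennreal\<close>, so that the dual functional is
  \<open>-\<infinity>\<close> (and not an artefact of the convention for non-integrable functions) when it diverges.\<close>

definition dual_functional ::
  "real \<Rightarrow> (real ^ 'dy) measure \<Rightarrow> ((real ^ 'dx) \<times> (real ^ 'dy)) measure \<Rightarrow>
   (real ^ 'dy \<Rightarrow> real) \<Rightarrow> (real ^ 'dy \<Rightarrow> real ^ 'dx) \<Rightarrow> ((real ^ 'dx) \<times> (real ^ 'dy) \<Rightarrow> real) \<Rightarrow> ereal"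
where
  "dual_functional \<epsilon> \<mu> \<nu> f g h =
     ereal (\<integral>u. f u \<partial>\<mu>) + ereal (\<integral>p. h p \<partial>\<nu>)
     - ereal \<epsilon> * enn2ereal (\<integral>\<^sup>+(u, x, y).
         ennreal (exp (1 / \<epsilon> * (f u + g u \<bullet> x + h (x, y) - cost u y))) \<partial>(\<mu> \<Otimes>\<^sub>M \<nu>))
     + ereal \<epsilon>"

definition L1_triples ::
  "(real ^ 'dy) measure \<Rightarrow> ((real ^ 'dx) \<times> (real ^ 'dy)) measure \<Rightarrow>
   ((real ^ 'dy \<Rightarrow> real) \<times> (real ^ 'dy \<Rightarrow> real ^ 'dx) \<times> ((real ^ 'dx) \<times> (real ^ 'dy) \<Rightarrow> real)) set"
where
  "L1_triples \<mu> \<nu> = {(f, g, h). integrable \<mu> f \<and> integrable \<mu> g \<and> integrable \<nu> h}"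

definition dual_potentials ::
  "real \<Rightarrow> (real ^ 'dy) measure \<Rightarrow> ((real ^ 'dx) \<times> (real ^ 'dy)) measure \<Rightarrow>
   (real ^ 'dy \<Rightarrow> real) \<Rightarrow> (real ^ 'dy \<Rightarrow> real ^ 'dx) \<Rightarrow> ((real ^ 'dx) \<times> (real ^ 'dy) \<Rightarrow> real) \<Rightarrow> bool"
where
  "dual_potentials \<epsilon> \<mu> \<nu> f g h \<longleftrightarrow>
     (f, g, h) \<in> L1_triples \<mu> \<nu> \<and>
     dual_functional \<epsilon> \<mu> \<nu> f g h =
       (SUP (f', g', h') \<in> L1_triples \<mu> \<nu>. dual_functional \<epsilon> \<mu> \<nu> f' g' h')"

end

theory Submission
  imports Defs "HOL-Complex_Analysis.Cauchy_Integral_Formula"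
begin

text \<open>
  Expanding \<open>cost u y = |u|\<^sup>2 / 2 - u \<bullet> y + |y|\<^sup>2 / 2\<close> turns the three equations into statements about
  Laplace transforms. Fix \<open>u0\<close> and absorb everything that depends on \<open>u0\<close> only into a finite measure
  \<open>N\<close> with a positive density with respect to \<open>\<nu>\<close>. Then, with \<open>Z z = \<integral> exp ((\<delta> z \<bullet> x + z \<bullet> y) / \<epsilon>) dN\<close>
  and \<open>\<delta> z = g (u0 + z) - g u0\<close>,
  \<open>f (u0 + z) = (|u0 + z|\<^sup>2 - |u0|\<^sup>2) / 2 - \<epsilon> ln (Z z)\<close>, and \<open>\<delta> z\<close> is a critical point of the convex function
  \<open>v \<mapsto> \<integral> exp ((v \<bullet> x + z \<bullet> y) / \<epsilon>) dN\<close>. Invertibility of \<open>E[X X\<^sup>T]\<close> makes this function strictly convex, so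
  \<open>\<delta> z\<close> is its only critical point, and makes its Hessian at \<open>0\<close> invertible, so \<open>\<delta>\<close> is the implicit
  function defined by the critical point equation.

  Analyticity is obtained by complexification. A real function which near each point extends to a bounded
  function of complex coordinates that is holomorphic in each variable separately is real analytic:
  expanding in one variable after the other gives the multivariate power series
  (\<open>sep_holomorphic_power_series\<close>, \<open>real_analytic_if_holomorphically_extends\<close>). The implicit function is extended
  by running the simplified Newton iteration with complex arguments; the iterates are separately
  holomorphic, since integrals of holomorphic functions depending on a parameter are holomorphic
  (\<open>holomorphic_on_parameter_integral\<close>), and they converge uniformly by contraction
  (\<open>implicit_holomorphic_solution\<close>). On real arguments the limit is real and solves the critical point equation,
  hence equals \<open>\<delta>\<close> (\<open>tilted_critical_point_holomorphic\<close>). This settles \<open>g\<close>; it settles \<open>f\<close> too, because \<open>Z\<close>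
  stays in a disc away from \<open>0\<close> on a small polydisc, where the complex logarithm is holomorphic
  (\<open>holomorphically_extends_at_log_integral_exp\<close>).

  Compactness of the supports of \<open>X\<close> and \<open>Y\<close> bounds the exponents above. For \<open>h\<close> one now knows that \<open>g\<close> is
  locally bounded, hence bounded on the compact support of \<open>\<mu>\<close>, so that \<open>h\<close> is, up to a quadratic
  polynomial, the logarithm of a Laplace transform of a finite measure with bounded support.
\<close>

section \<open>Integrals depending holomorphically on a parameter\<close>

text \<open>Differentiation under the integral sign; Cauchy's inequality bounds the difference quotients by a
  multiple of the dominating function, so no hypothesis on the derivative is needed.\<close>

lemma holomorphic_on_parameter_integral:
  fixes G :: "complex \<Rightarrow> 'p \<Rightarrow> complex"
  assumes S: "open S"
    and hol: "\<And>p. p \<in> space N \<Longrightarrow> (\<lambda>\<zeta>. G \<zeta> p) holomorphic_on S"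
    and meas: "\<And>\<zeta>. \<zeta> \<in> S \<Longrightarrow> G \<zeta> \<in> borel_measurable N"
    and D: "integrable N D"
    and bound: "AE p in N. \<forall>\<zeta>\<in>S. norm (G \<zeta> p) \<le> D p"
  shows "(\<lambda>\<zeta>. \<integral>p. G \<zeta> p \<partial>N) holomorphic_on S"
proof -
  have integ: "integrable N (G \<zeta>)" if "\<zeta> \<in> S" for \<zeta>
    by (rule Bochner_Integration.integrable_bound[OF D meas[OF that]])
       (use bound that in \<open>auto elim!: eventually_mono\<close>)
  have "\<exists>d. ((\<lambda>\<zeta>. \<integral>p. G \<zeta> p \<partial>N) has_field_derivative d) (at z)" if z: "z \<in> S" for z
  proof -
    obtain e where e: "e > 0" "ball z e \<subseteq> S"
      using S z openE by blast
    define \<delta> where "\<delta> = e / 3"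
    have \<delta>: "\<delta> > 0" using e by (simp add: \<delta>_def)
    have sub: "cball \<xi> \<delta> \<subseteq> S" if "\<xi> \<in> ball z \<delta>" for \<xi>
    proof
      fix x assume "x \<in> cball \<xi> \<delta>"
      then have "dist z x \<le> dist z \<xi> + dist \<xi> x" "dist \<xi> x \<le> \<delta>" "dist z \<xi> < \<delta>"
        using that by (auto intro: dist_triangle)
      then show "x \<in> S" using e \<delta> by (auto simp: \<delta>_def)
    qed
    \<comment> \<open>A third of the radius keeps a disc of radius \<open>\<delta>\<close> about each point of \<open>ball z \<delta>\<close> inside \<open>S\<close>.\<close>
    define G' where "G' p = deriv (\<lambda>\<zeta>. G \<zeta> p) z" for p
    have lip: "AE p in N. \<forall>\<zeta>\<in>ball z \<delta>. norm (G \<zeta> p - G z p) \<le> D p / \<delta> * norm (\<zeta> - z)"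
      using bound AE_space
    proof eventually_elim
      case (elim p)
      show ?case
      proof
        fix \<zeta> assume \<zeta>: "\<zeta> \<in> ball z \<delta>"
        show "norm (G \<zeta> p - G z p) \<le> D p / \<delta> * norm (\<zeta> - z)"
        proof (rule field_differentiable_bound[of "ball z \<delta>" "\<lambda>\<zeta>. G \<zeta> p" "deriv (\<lambda>\<zeta>. G \<zeta> p)"])
          fix \<xi> assume \<xi>: "\<xi> \<in> ball z \<delta>"
          have "\<xi> \<in> S" using sub[OF \<xi>] \<delta> by auto
          then show "((\<lambda>\<zeta>. G \<zeta> p) has_field_derivative deriv (\<lambda>\<zeta>. G \<zeta> p) \<xi>) (at \<xi> within ball z \<delta>)"
            using hol[OF elim(2)] S
            by (meson has_field_derivative_at_within holomorphic_derivI)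
          have "norm ((deriv ^^ 1) (\<lambda>\<zeta>. G \<zeta> p) \<xi>) \<le> fact 1 * D p / \<delta> ^ 1"
          proof (rule Cauchy_inequality)
            show "(\<lambda>\<zeta>. G \<zeta> p) holomorphic_on ball \<xi> \<delta>"
              using hol[OF elim(2)] sub[OF \<xi>] ball_subset_cball by (meson holomorphic_on_subset order_trans)
            show "continuous_on (cball \<xi> \<delta>) (\<lambda>\<zeta>. G \<zeta> p)"
              using hol[OF elim(2)] sub[OF \<xi>] holomorphic_on_imp_continuous_on holomorphic_on_subset by blast
            show "norm (G x p) \<le> D p" if "norm (\<xi> - x) = \<delta>" for x
              using elim(1) sub[OF \<xi>] that by (auto simp: dist_norm)
          qed (use \<delta> in auto)
          then show "norm (deriv (\<lambda>\<zeta>. G \<zeta> p) \<xi>) \<le> D p / \<delta>" by simp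
        qed (use \<zeta> \<delta> in auto)
      qed
    qed
    have "((\<lambda>y. ((\<integral>p. G y p \<partial>N) - (\<integral>p. G z p \<partial>N)) / (y - z)) \<longlongrightarrow> (\<integral>p. G' p \<partial>N)) (at z within ball z \<delta>)"
      unfolding tendsto_at_iff_sequentially
    proof (intro allI impI)
      fix X :: "nat \<Rightarrow> complex"
      assume X: "\<forall>i. X i \<in> ball z \<delta> - {z}" and lim: "X \<longlonglongrightarrow> z"
      have XS: "X i \<in> S" for i
      proof -
        have "X i \<in> ball z e"
          using X[rule_format, of i] e(1) by (simp add: \<delta>_def)
        then show ?thesis using e(2) by blast
      qed
      define q where "q i p = (G (X i) p - G z p) / (X i - z)" for i p
      have qm: "q i \<in> borel_measurable N" for i
        unfolding q_def using meas[OF XS] meas[OF z] by measurable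
      have qlim: "(\<lambda>i. q i p) \<longlonglongrightarrow> G' p" if p: "p \<in> space N" for p
      proof -
        have "((\<lambda>\<zeta>. G \<zeta> p) has_field_derivative G' p) (at z)"
          unfolding G'_def using hol[OF p] S z by (simp add: holomorphic_derivI)
        then have "((\<lambda>y. (G y p - G z p) / (y - z)) \<longlongrightarrow> G' p) (at z)"
          by (simp add: has_field_derivative_iff)
        then show ?thesis
          unfolding tendsto_at_iff_sequentially using X lim by (auto simp: q_def[abs_def] o_def)
      qed
      have "(\<lambda>i. \<integral>p. q i p \<partial>N) \<longlonglongrightarrow> (\<integral>p. G' p \<partial>N)"
      proof (rule integral_dominated_convergence[where w="\<lambda>p. D p / \<delta>"])
        show "G' \<in> borel_measurable N"
          by (rule borel_measurable_LIMSEQ_metric[OF qm qlim])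
        show "integrable N (\<lambda>p. D p / \<delta>)" using D by simp
        show "AE p in N. (\<lambda>i. q i p) \<longlonglongrightarrow> G' p" using qlim by auto
        show "AE p in N. norm (q i p) \<le> D p / \<delta>" for i
          using lip
        proof eventually_elim
          case (elim p)
          then show ?case using X[rule_format, of i]
            by (auto simp: q_def norm_divide divide_simps)
        qed
      qed (rule qm)
      moreover have "(\<integral>p. q i p \<partial>N) = ((\<integral>p. G (X i) p \<partial>N) - (\<integral>p. G z p \<partial>N)) / (X i - z)" for i
        unfolding q_def using integ[OF XS] integ[OF z] by simp
      ultimately show "((\<lambda>y. ((\<integral>p. G y p \<partial>N) - (\<integral>p. G z p \<partial>N)) / (y - z)) \<circ> X) \<longlonglongrightarrow> (\<integral>p. G' p \<partial>N)"
        by (simp add: o_def)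
    qed
    then show ?thesis
      using \<delta> by (auto simp: has_field_derivative_iff at_within_open[of z "ball z \<delta>"])
  qed
  then show ?thesis
    using S by (auto simp: holomorphic_on_open)
qed

text \<open>Writing Taylor coefficients as means over a circle makes them integrals of \<open>F\<close>; if \<open>F\<close> depends
  holomorphically on further variables, then so do its coefficients.\<close>

lemma taylor_coeff_eq_circle_mean:
  assumes hol: "F holomorphic_on ball 0 R" and r: "0 < r" "r < R"
  shows "(deriv ^^ k) F 0 / fact k =
    (\<integral>t. F (circlepath 0 r t) / circlepath 0 r t ^ k \<partial>lebesgue_on {0..1})"
proof -
  let ?\<gamma> = "circlepath 0 r"
  have \<gamma>: "norm (?\<gamma> t) = r" for t
    using r by (simp add: circlepath norm_mult)
  have \<gamma>0: "?\<gamma> t \<noteq> 0" for t using \<gamma>[of t] r by auto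
  have cont: "continuous_on A ?\<gamma>" for A
    unfolding circlepath by (intro continuous_intros)
  have "continuous_on {0..1} (F \<circ> ?\<gamma>)"
    by (intro continuous_on_compose cont continuous_on_subset[OF holomorphic_on_imp_continuous_on[OF hol]])
       (use \<gamma> r in auto)
  then have cF: "continuous_on {0..1} (\<lambda>t. F (?\<gamma> t))" by (simp add: o_def)
  define c where "c t = F (?\<gamma> t) / ?\<gamma> t ^ k" for t
  have cc: "continuous_on {0..1} c"
    unfolding c_def by (intro continuous_intros cF cont) (use \<gamma>0 in auto)
  have "c absolutely_integrable_on {0..1}"
    using cc absolutely_integrable_continuous[of 0 1 c] by (simp add: cbox_interval)
  then have ic: "integrable (lebesgue_on {0..1}) c"
    by (simp add: set_integrable_def integrable_restrict_space)
  have "((\<lambda>u. F u / (u - 0) ^ Suc k) has_contour_integral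
      ((2 * pi * \<i>) / (fact k) * (deriv ^^ k) F 0)) ?\<gamma>"
    by (rule Cauchy_has_contour_integral_higher_derivative_circlepath)
       (use r in \<open>auto intro!: holomorphic_on_imp_continuous_on holomorphic_on_subset[OF hol]\<close>)
  then have "((\<lambda>t. F (?\<gamma> t) / ?\<gamma> t ^ Suc k * vector_derivative ?\<gamma> (at t)) has_integral
      ((2 * pi * \<i>) / (fact k) * (deriv ^^ k) F 0)) {0..1}"
    by (simp add: has_contour_integral)
  moreover have "F (?\<gamma> t) / ?\<gamma> t ^ Suc k * vector_derivative ?\<gamma> (at t) = (2 * pi * \<i>) * c t" for t
    using \<gamma>0[of t] r unfolding vector_derivative_circlepath c_def
    by (simp add: circlepath field_simps)
  ultimately have "((\<lambda>t. (2 * pi * \<i>) * c t) has_integral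
      ((2 * pi * \<i>) * ((deriv ^^ k) F 0 / fact k))) {0..1}" by simp
  then have "(c has_integral ((deriv ^^ k) F 0 / fact k)) {0..1}"
    by (subst (asm) has_integral_mult_right_iff) auto
  moreover have "(c has_integral (\<integral>t. c t \<partial>lebesgue_on {0..1})) {0..1}"
    by (rule has_integral_integral_lebesgue_on[OF ic]) simp
  ultimately show ?thesis unfolding c_def by (rule has_integral_unique)
qed

section \<open>Power series of separately holomorphic functions\<close>

text \<open>Open polydisc of radius \<open>R\<close> about the origin, in the complex variables indexed by \<open>B\<close>. Points are
  functions on the whole index type, set to \<open>0\<close> outside \<open>B\<close>.\<close>

definition polydisc :: "'b set \<Rightarrow> real \<Rightarrow> ('b \<Rightarrow> complex) set" where
  "polydisc B R = {w. (\<forall>b\<in>B. norm (w b) < R) \<and> (\<forall>b. b \<notin> B \<longrightarrow> w b = 0)}"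

text \<open>\<open>F\<close> is holomorphic on the polydisc in each of the variables indexed by \<open>B\<close> separately.\<close>

definition sep_holomorphic :: "'b set \<Rightarrow> real \<Rightarrow> (('b \<Rightarrow> complex) \<Rightarrow> complex) \<Rightarrow> bool" where
  "sep_holomorphic B R F \<longleftrightarrow>
     (\<forall>w\<in>polydisc B R. \<forall>b\<in>B. (\<lambda>\<zeta>. F (w(b := \<zeta>))) holomorphic_on ball 0 R)"

lemma polydisc_upd:
  assumes "w \<in> polydisc B R" "norm \<zeta> < R"
  shows "w(b := \<zeta>) \<in> polydisc (insert b B) R"
  using assms by (auto simp: polydisc_def)

lemma polydisc_insertD:
  assumes "w \<in> polydisc (insert b B) R" "b \<notin> B"
  shows "w(b := 0) \<in> polydisc B R" "norm (w b) < R"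
  using assms by (auto simp: polydisc_def)

text \<open>A multi-index on \<open>insert b0 B\<close> is its exponent at \<open>b0\<close> together with a multi-index on \<open>B\<close>.\<close>

lemma multi_index_insert_bij:
  assumes "b0 \<notin> B"
  shows "bij_betw (\<lambda>(k, \<alpha>). \<alpha>(b0 := k)) (UNIV \<times> {\<alpha>. \<forall>b. b \<notin> B \<longrightarrow> \<alpha> b = (0::nat)})
     {\<alpha>. \<forall>b. b \<notin> insert b0 B \<longrightarrow> \<alpha> b = 0}"
  by (rule bij_betwI[where g="\<lambda>\<alpha>. (\<alpha> b0, \<alpha>(b0 := 0))"]) (use assms in \<open>auto simp: fun_eq_iff\<close>)

text \<open>A bounded separately holomorphic function is the sum of an absolutely convergent multivariate power
  series. The proof is by induction on the number of variables: the coefficients of the expansion in one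
  variable are bounded and separately holomorphic in the others. The explicit bound on the sum of the
  absolute values is what makes the resulting double series summable.\<close>

lemma sep_holomorphic_power_series:
  fixes F :: "('b \<Rightarrow> complex) \<Rightarrow> complex"
  assumes "finite B" and s: "0 < s" "s < r" "r < R"
    and "sep_holomorphic B R F"
    and "\<And>w. w \<in> polydisc B R \<Longrightarrow> norm (F w) \<le> M"
  shows "\<exists>C. (\<exists>S\<le>M * (r / (r - s)) ^ card B.
        ((\<lambda>\<alpha>. norm (C \<alpha>) * (\<Prod>b\<in>B. s ^ \<alpha> b)) has_sum S) {\<alpha>. \<forall>b. b \<notin> B \<longrightarrow> \<alpha> b = 0}) \<and>
      (\<forall>w\<in>polydisc B s.
        ((\<lambda>\<alpha>. C \<alpha> * (\<Prod>b\<in>B. w b ^ \<alpha> b)) has_sum F w) {\<alpha>. \<forall>b. b \<notin> B \<longrightarrow> \<alpha> b = 0})"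
  using assms(1,5,6)
proof (induction B arbitrary: F M rule: finite_induct)
  case empty
  have *: "{\<alpha>::'b \<Rightarrow> nat. \<forall>b. \<alpha> b = 0} = {\<lambda>_. 0}" by auto
  have p: "polydisc {} t = {\<lambda>_::'b. 0}" for t by (auto simp: polydisc_def)
  show ?case
    using empty by (intro exI[of _ "\<lambda>_. F (\<lambda>_. 0)"]) (auto simp: * p intro!: exI[of _ "norm (F (\<lambda>_. 0))"] has_sum_finiteI)
next
  case (insert b0 B)
  let ?I = "{\<alpha>. \<forall>b. b \<notin> B \<longrightarrow> \<alpha> b = (0::nat)}"
  let ?\<gamma> = "circlepath 0 r"
  have R: "0 < R" "0 < r" using s by auto
  have \<gamma>: "norm (?\<gamma> t) = r" for t
    using R by (simp add: circlepath norm_mult)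
  have \<gamma>0: "?\<gamma> t \<noteq> 0" for t using \<gamma>[of t] R by auto
  have cont: "continuous_on A ?\<gamma>" for A
    unfolding circlepath by (intro continuous_intros)
  have M: "norm (F w) \<le> M" if "w \<in> polydisc (insert b0 B) R" for w
    using insert.prems that by auto
  have slice: "(\<lambda>\<zeta>. F (w(b0 := \<zeta>))) holomorphic_on ball 0 R" if "w \<in> polydisc B R" for w
  proof -
    have "w \<in> polydisc (insert b0 B) R"
      using that R by (auto simp: polydisc_def)
    then show ?thesis using insert.prems(1) by (auto simp: sep_holomorphic_def)
  qed
  \<comment> \<open>The \<open>k\<close>-th Taylor coefficient in the variable \<open>b0\<close>, as a function of the other variables.\<close>
  define Fk where "Fk k w = (\<integral>t. F (w(b0 := ?\<gamma> t)) / ?\<gamma> t ^ k \<partial>lebesgue_on {0..1})" for k w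
  have meas: "(\<lambda>t. F (w(b0 := ?\<gamma> t)) / ?\<gamma> t ^ k) \<in> borel_measurable (lebesgue_on {0..1})"
    if w: "w \<in> polydisc B R" for k w
  proof (rule continuous_imp_measurable_on_sets_lebesgue)
    have "continuous_on {0..1} ((\<lambda>\<zeta>. F (w(b0 := \<zeta>))) \<circ> ?\<gamma>)"
      by (intro continuous_on_compose cont continuous_on_subset[OF holomorphic_on_imp_continuous_on[OF slice[OF w]]])
         (use \<gamma> s in auto)
    then show "continuous_on {0..1} (\<lambda>t. F (w(b0 := ?\<gamma> t)) / ?\<gamma> t ^ k)"
      by (intro continuous_intros cont) (use \<gamma>0 in \<open>auto simp: o_def\<close>)
  qed auto
  have ibd: "norm (F (w(b0 := ?\<gamma> t)) / ?\<gamma> t ^ k) \<le> M / r ^ k" if "w \<in> polydisc B R" for k w t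
    using M[OF polydisc_upd[OF that, of "?\<gamma> t" b0]] s R
    by (auto simp: norm_divide norm_power \<gamma> intro!: divide_right_mono)
  have bd: "norm (Fk k w) \<le> M / r ^ k" if w: "w \<in> polydisc B R" for k w
  proof -
    have "norm (Fk k w) \<le> (\<integral>t. M / r ^ k \<partial>lebesgue_on {0..1::real})"
      unfolding Fk_def
      by (rule Bochner_Integration.integral_norm_bound_integral)
         (use ibd[OF w] meas[OF w] in \<open>auto intro!: integrable_const_ivl finite_measure.integrable_const_bound[where B="M / r ^ k"] finite_measure_lebesgue_on\<close>)
    also have "\<dots> = M / r ^ k"
      by (simp add: measure_restrict_space)
    finally show ?thesis .
  qed
  have hol: "sep_holomorphic B R (Fk k)" for k
    unfolding sep_holomorphic_def
  proof (intro ballI)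
    fix w b assume w: "w \<in> polydisc B R" and b: "b \<in> B"
    have wz: "w(b := \<zeta>) \<in> polydisc B R" if "\<zeta> \<in> ball 0 R" for \<zeta>
      using polydisc_upd[OF w, of \<zeta> b] that b by (simp add: insert_absorb)
    show "(\<lambda>\<zeta>. Fk k (w(b := \<zeta>))) holomorphic_on ball 0 R"
      unfolding Fk_def
    proof (rule holomorphic_on_parameter_integral[where D="\<lambda>_. M / r ^ k"])
      fix t
      have "b \<noteq> b0" using b insert.hyps by auto
      then have "(\<lambda>\<zeta>. F (w(b := \<zeta>, b0 := ?\<gamma> t))) = (\<lambda>\<zeta>. F (w(b0 := ?\<gamma> t, b := \<zeta>)))"
        by (simp add: fun_upd_twist)
      moreover have "w(b0 := ?\<gamma> t) \<in> polydisc (insert b0 B) R"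
        using \<gamma> s by (intro polydisc_upd[OF w]) auto
      ultimately show "(\<lambda>\<zeta>. F (w(b := \<zeta>, b0 := ?\<gamma> t)) / ?\<gamma> t ^ k) holomorphic_on ball 0 R"
        using insert.prems(1) b \<gamma>0[of t]
        by (intro holomorphic_intros) (auto simp: sep_holomorphic_def)
    qed (use meas[OF wz] ibd[OF wz] in auto)
  qed
  define P where "P k C \<longleftrightarrow> (\<exists>S\<le>M / r ^ k * (r / (r - s)) ^ card B.
        ((\<lambda>\<alpha>. norm (C \<alpha>) * (\<Prod>b\<in>B. s ^ \<alpha> b)) has_sum S) ?I) \<and>
      (\<forall>w\<in>polydisc B s. ((\<lambda>\<alpha>. C \<alpha> * (\<Prod>b\<in>B. w b ^ \<alpha> b)) has_sum Fk k w) ?I)"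
    for k and C :: "('b \<Rightarrow> nat) \<Rightarrow> complex"
  have exP: "\<exists>C. P k C" for k
    unfolding P_def by (rule insert.IH[OF hol bd])
  have "\<exists>C. \<forall>k. P k (C k)"
    by (rule choice, rule allI, rule exP)
  then obtain C where C: "\<And>k. P k (C k)" by blast
  have "\<forall>k. \<exists>S. S \<le> M / r ^ k * (r / (r - s)) ^ card B \<and>
        ((\<lambda>\<alpha>. norm (C k \<alpha>) * (\<Prod>b\<in>B. s ^ \<alpha> b)) has_sum S) ?I"
    using C unfolding P_def by blast
  from choice[OF this] obtain S where S: "\<And>k. S k \<le> M / r ^ k * (r / (r - s)) ^ card B"
     "\<And>k. ((\<lambda>\<alpha>. norm (C k \<alpha>) * (\<Prod>b\<in>B. s ^ \<alpha> b)) has_sum S k) ?I"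
    by blast
  have series: "((\<lambda>\<alpha>. C k \<alpha> * (\<Prod>b\<in>B. w b ^ \<alpha> b)) has_sum Fk k w) ?I" if "w \<in> polydisc B s" for k w
    using C[of k] that unfolding P_def by blast
  define C' where "C' \<alpha> = C (\<alpha> b0) (\<alpha>(b0 := 0))" for \<alpha>
  have C'_upd: "C' (\<alpha>(b0 := k)) = C k \<alpha>" if "\<alpha> \<in> ?I" for k \<alpha>
    using that insert.hyps by (simp add: C'_def fun_upd_idem)
  have prod_upd: "(\<Prod>b\<in>insert b0 B. f b ^ (\<alpha>(b0 := k)) b) = f b0 ^ k * (\<Prod>b\<in>B. f b ^ \<alpha> b)"
    for f :: "'b \<Rightarrow> 'c::comm_monoid_mult" and k \<alpha>
  proof -
    have "(\<Prod>b\<in>B. f b ^ (\<alpha>(b0 := k)) b) = (\<Prod>b\<in>B. f b ^ \<alpha> b)"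
      using insert.hyps by (intro prod.cong) auto
    then show ?thesis using insert.hyps by simp
  qed
  have reindex: "(h has_sum v) {\<alpha>. \<forall>b. b \<notin> insert b0 B \<longrightarrow> \<alpha> b = 0} \<longleftrightarrow>
     ((\<lambda>(k, \<alpha>). h (\<alpha>(b0 := k))) has_sum v) (UNIV \<times> ?I)" for h v
    by (subst has_sum_reindex_bij_betw[OF multi_index_insert_bij[OF insert.hyps(2)], symmetric])
       (simp add: case_prod_unfold)
  have S0: "0 \<le> S k" for k
    using S(2)[of k] by (rule has_sum_nonneg) (use s in \<open>auto intro!: mult_nonneg_nonneg prod_nonneg\<close>)
  \<comment> \<open>The inner sums are dominated by a geometric series, so the double series is summable.\<close>
  define Q where "Q = M * (r / (r - s)) ^ card B"
  have "(\<lambda>k. Q * (s / r) ^ k) sums (Q * (1 / (1 - s / r)))"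
    using s by (intro sums_mult geometric_sums) auto
  then have geo: "((\<lambda>k. Q * (s / r) ^ k) has_sum (Q * (1 / (1 - s / r)))) UNIV"
    by (intro sums_nonneg_imp_has_sum)
       (use s S0[of 0] S(1)[of 0] in \<open>auto simp: Q_def intro!: mult_nonneg_nonneg\<close>)
  have Sle: "s ^ k * S k \<le> Q * (s / r) ^ k" for k
    using mult_left_mono[OF S(1)[of k], of "s ^ k"] s by (simp add: Q_def power_divide field_simps)
  have sumS: "(\<lambda>k. s ^ k * S k) summable_on UNIV"
    by (rule summable_on_comparison_test[OF has_sum_imp_summable[OF geo]])
       (use Sle S0 s in auto)
  then obtain T where T: "((\<lambda>k. s ^ k * S k) has_sum T) UNIV" by (auto simp: summable_on_def)
  have Tle: "T \<le> M * (r / (r - s)) ^ card (insert b0 B)"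
  proof -
    have "T \<le> Q * (1 / (1 - s / r))"
      by (rule has_sum_mono[OF T geo Sle])
    also have "\<dots> = M * (r / (r - s)) ^ card (insert b0 B)"
      using insert.hyps s by (simp add: Q_def field_simps)
    finally show ?thesis .
  qed
  have inner: "((\<lambda>\<alpha>. norm (C k \<alpha>) * (s ^ k * (\<Prod>b\<in>B. s ^ \<alpha> b))) has_sum s ^ k * S k) ?I" for k
    using has_sum_cmult_right[OF S(2)[of k], of "s ^ k"] by (simp add: mult_ac)
  have total: "((\<lambda>(k, \<alpha>). norm (C k \<alpha>) * (s ^ k * (\<Prod>b\<in>B. s ^ \<alpha> b))) has_sum T) (UNIV \<times> ?I)"
    by (rule has_sum_SigmaI[where g="\<lambda>k. s ^ k * S k"])
       (use inner T sumS s in \<open>auto intro!: summable_on_SigmaI[where g="\<lambda>k. s ^ k * S k"] mult_nonneg_nonneg prod_nonneg\<close>)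
  have "((\<lambda>\<alpha>. norm (C' \<alpha>) * (\<Prod>b\<in>insert b0 B. s ^ \<alpha> b)) has_sum T)
      {\<alpha>. \<forall>b. b \<notin> insert b0 B \<longrightarrow> \<alpha> b = 0}"
    unfolding reindex using total
    by (rule has_sum_cong[THEN iffD1, rotated]) (clarsimp simp del: fun_upd_apply simp add: prod_upd C'_upd)
  moreover have "((\<lambda>\<alpha>. C' \<alpha> * (\<Prod>b\<in>insert b0 B. w b ^ \<alpha> b)) has_sum F w)
      {\<alpha>. \<forall>b. b \<notin> insert b0 B \<longrightarrow> \<alpha> b = 0}" if w: "w \<in> polydisc (insert b0 B) s" for w
  proof -
    define w' where "w' = w(b0 := 0)"
    have w': "w' \<in> polydisc B s" and wb: "norm (w b0) < s"
      using polydisc_insertD[OF w insert.hyps(2)] by (auto simp: w'_def)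
    have w'R: "w' \<in> polydisc B R" using w' s by (force simp: polydisc_def)
    have pw: "(\<Prod>b\<in>B. w' b ^ \<alpha> b) = (\<Prod>b\<in>B. w b ^ \<alpha> b)" for \<alpha>
      using insert.hyps by (intro prod.cong) (auto simp: w'_def)
    have "(\<lambda>k. (deriv ^^ k) (\<lambda>\<zeta>. F (w'(b0 := \<zeta>))) 0 / fact k * (w b0 - 0) ^ k)
       sums F (w'(b0 := w b0))"
      by (rule holomorphic_power_series[OF slice[OF w'R]]) (use wb s in auto)
    then have sums: "(\<lambda>k. w b0 ^ k * Fk k w') sums F w"
      unfolding Fk_def taylor_coeff_eq_circle_mean[OF slice[OF w'R] R(2) s(3)]
      by (simp add: mult.commute w'_def)
    have le: "norm (w b) \<le> s" if "b \<in> insert b0 B" for b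
      using w that by (force simp: polydisc_def less_imp_le)
    have abs: "(\<lambda>x. norm (case x of (k, \<alpha>) \<Rightarrow> C k \<alpha> * (w b0 ^ k * (\<Prod>b\<in>B. w b ^ \<alpha> b))))
        summable_on (UNIV \<times> ?I)"
    proof (rule summable_on_comparison_test[OF has_sum_imp_summable[OF total]])
      fix x :: "nat \<times> ('b \<Rightarrow> nat)" assume "x \<in> UNIV \<times> ?I"
      show "norm (case x of (k, \<alpha>) \<Rightarrow> C k \<alpha> * (w b0 ^ k * (\<Prod>b\<in>B. w b ^ \<alpha> b))) \<le>
        (case x of (k, \<alpha>) \<Rightarrow> norm (C k \<alpha>) * (s ^ k * (\<Prod>b\<in>B. s ^ \<alpha> b)))"
        using le s
        by (cases x) (auto simp: norm_mult norm_power prod_norm[symmetric]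
            intro!: mult_left_mono mult_mono power_mono prod_mono prod_nonneg)
    qed auto
    have in1: "((\<lambda>\<alpha>. C k \<alpha> * (w b0 ^ k * (\<Prod>b\<in>B. w b ^ \<alpha> b))) has_sum w b0 ^ k * Fk k w') ?I" for k
      using has_sum_cmult_right[OF series[OF w', of k], of "w b0 ^ k"] by (simp add: pw mult_ac)
    have tot: "((\<lambda>(k, \<alpha>). C k \<alpha> * (w b0 ^ k * (\<Prod>b\<in>B. w b ^ \<alpha> b))) has_sum
        (\<Sum>\<^sub>\<infinity>(k, \<alpha>)\<in>UNIV \<times> ?I. C k \<alpha> * (w b0 ^ k * (\<Prod>b\<in>B. w b ^ \<alpha> b)))) (UNIV \<times> ?I)"
      by (rule has_sum_infsum[OF abs_summable_summable[OF abs]])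
    have "((\<lambda>k. w b0 ^ k * Fk k w') has_sum
        (\<Sum>\<^sub>\<infinity>(k, \<alpha>)\<in>UNIV \<times> ?I. C k \<alpha> * (w b0 ^ k * (\<Prod>b\<in>B. w b ^ \<alpha> b)))) UNIV"
      by (rule has_sum_SigmaD[OF tot]) (use in1 in auto)
    from has_sum_imp_sums[OF this] sums
    have "(\<Sum>\<^sub>\<infinity>(k, \<alpha>)\<in>UNIV \<times> ?I. C k \<alpha> * (w b0 ^ k * (\<Prod>b\<in>B. w b ^ \<alpha> b))) = F w"
      by (rule sums_unique2)
    with tot have "((\<lambda>(k, \<alpha>). C k \<alpha> * (w b0 ^ k * (\<Prod>b\<in>B. w b ^ \<alpha> b))) has_sum F w) (UNIV \<times> ?I)"
      by simp
    then show ?thesis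
      unfolding reindex
      by (rule has_sum_cong[THEN iffD1, rotated]) (clarsimp simp del: fun_upd_apply simp add: prod_upd C'_upd)
  qed
  ultimately show ?case using Tle by blast
qed

section \<open>Real analyticity from holomorphic extensions\<close>

text \<open>The coordinates of a real vector, regarded as complex numbers.\<close>

definition complexify :: "'a::euclidean_space \<Rightarrow> 'a \<Rightarrow> complex" where
  "complexify z = (\<lambda>b. if b \<in> Basis then complex_of_real (z \<bullet> b) else 0)"

lemma complexify_Basis: "b \<in> Basis \<Longrightarrow> complexify z b = complex_of_real (z \<bullet> b)"
  by (simp add: complexify_def)

lemma complexify_in_polydisc_iff:
  "complexify z \<in> polydisc Basis R \<longleftrightarrow> (\<forall>b\<in>Basis. \<bar>z \<bullet> b\<bar> < R)"
  by (auto simp: polydisc_def complexify_def)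

text \<open>On a cube around \<open>a\<close>, the function \<open>\<phi>\<close> is the restriction of a bounded separately holomorphic function
  on a polydisc. Polydiscs are centred at \<open>0\<close>, so the complex variables are the coordinates relative to \<open>a\<close>.\<close>

definition holomorphically_extends_at :: "('a::euclidean_space \<Rightarrow> real) \<Rightarrow> 'a \<Rightarrow> bool" where
  "holomorphically_extends_at \<phi> a \<longleftrightarrow> (\<exists>R>0. \<exists>F M. sep_holomorphic Basis R F \<and>
     (\<forall>w\<in>polydisc Basis R. norm (F w) \<le> M) \<and>
     (\<forall>z. complexify z \<in> polydisc Basis R \<longrightarrow> F (complexify z) = complex_of_real (\<phi> (a + z))))"

lemma holomorphically_extends_atI:
  assumes "R > 0" "sep_holomorphic Basis R F" "\<And>w. w \<in> polydisc Basis R \<Longrightarrow> norm (F w) \<le> M"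
    "\<And>z. complexify z \<in> polydisc Basis R \<Longrightarrow> F (complexify z) = complex_of_real (\<phi> (a + z))"
  shows "holomorphically_extends_at \<phi> a"
  using assms unfolding holomorphically_extends_at_def by blast

lemma real_analytic_if_holomorphically_extends:
  fixes \<phi> :: "'a::euclidean_space \<Rightarrow> real"
  assumes "\<And>a. holomorphically_extends_at \<phi> a"
  shows "real_analytic \<phi>"
  unfolding real_analytic_def
proof
  fix a :: 'a
  obtain R F M where R: "R > 0" and F: "sep_holomorphic Basis R F"
      "\<And>w. w \<in> polydisc Basis R \<Longrightarrow> norm (F w) \<le> M"
    and ext: "\<And>z. complexify z \<in> polydisc Basis R \<Longrightarrow> F (complexify z) = complex_of_real (\<phi> (a + z))"
    using assms[of a] unfolding holomorphically_extends_at_def by blast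
  define s where "s = R / 3"
  have s: "0 < s" "s < 2 * R / 3" "2 * R / 3 < R" using R by (auto simp: s_def)
  obtain C where C: "\<And>w. w \<in> polydisc Basis s \<Longrightarrow>
      ((\<lambda>\<alpha>. C \<alpha> * (\<Prod>b\<in>Basis. w b ^ \<alpha> b)) has_sum F w) {\<alpha>::'a \<Rightarrow> nat. \<forall>b. b \<notin> Basis \<longrightarrow> \<alpha> b = 0}"
    using sep_holomorphic_power_series[OF finite_Basis s F] by blast
  show "\<exists>r>0. \<exists>C. \<forall>z\<in>ball a r.
        ((\<lambda>\<alpha>. C \<alpha> * (\<Prod>b\<in>Basis. ((z - a) \<bullet> b) ^ \<alpha> b)) has_sum \<phi> z) multi_indices"
  proof (intro exI[of _ s] conjI exI[of _ "\<lambda>\<alpha>. Re (C \<alpha>)"] ballI s(1))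
    fix z assume z: "z \<in> ball a s"
    have small: "\<bar>(z - a) \<bullet> b\<bar> < s" if "b \<in> Basis" for b
      using Basis_le_norm[OF that, of "z - a"] z by (simp add: dist_norm norm_minus_commute)
    then have in_s: "complexify (z - a) \<in> polydisc Basis s"
      and in_R: "complexify (z - a) \<in> polydisc Basis R"
      using s by (force simp: complexify_in_polydisc_iff)+
    have eq: "C \<alpha> * (\<Prod>b\<in>Basis. complexify (z - a) b ^ \<alpha> b) =
        C \<alpha> * of_real (\<Prod>b\<in>Basis. ((z - a) \<bullet> b) ^ \<alpha> b)" for \<alpha>
      by (simp add: complexify_def)
    have "((\<lambda>\<alpha>. Re (C \<alpha> * of_real (\<Prod>b\<in>Basis. ((z - a) \<bullet> b) ^ \<alpha> b))) has_sum
        Re (F (complexify (z - a)))) multi_indices"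
      using has_sum_Re[OF C[OF in_s]] unfolding eq multi_indices_def .
    then show "((\<lambda>\<alpha>. Re (C \<alpha>) * (\<Prod>b\<in>Basis. ((z - a) \<bullet> b) ^ \<alpha> b)) has_sum \<phi> z) multi_indices"
      using ext[OF in_R] by (simp del: of_real_prod)
  qed
qed

lemma polydisc_mono: "R \<le> R' \<Longrightarrow> polydisc B R \<subseteq> polydisc B R'"
  by (force simp: polydisc_def)

lemma sep_holomorphic_subset:
  assumes "sep_holomorphic B R' F" "R \<le> R'"
  shows "sep_holomorphic B R F"
proof -
  have "ball (0::complex) R \<subseteq> ball 0 R'" using assms by auto
  then show ?thesis
    using assms polydisc_mono[OF assms(2), of B] unfolding sep_holomorphic_def
    by (meson holomorphic_on_subset subsetD)
qed

lemma sep_holomorphic_coordinate: "sep_holomorphic B R (\<lambda>w. w b)"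
  unfolding sep_holomorphic_def
proof (intro ballI)
  fix w b'
  show "(\<lambda>\<zeta>. (w(b' := \<zeta>)) b) holomorphic_on ball 0 R"
    by (cases "b = b'") auto
qed

lemma sep_holomorphic_const: "sep_holomorphic B R (\<lambda>w. c)"
  by (simp add: sep_holomorphic_def)

lemma sep_holomorphic_add:
  "sep_holomorphic B R F \<Longrightarrow> sep_holomorphic B R G \<Longrightarrow> sep_holomorphic B R (\<lambda>w. F w + G w)"
  unfolding sep_holomorphic_def by (intro ballI holomorphic_intros) auto

lemma sep_holomorphic_diff:
  "sep_holomorphic B R F \<Longrightarrow> sep_holomorphic B R G \<Longrightarrow> sep_holomorphic B R (\<lambda>w. F w - G w)"
  unfolding sep_holomorphic_def by (intro ballI holomorphic_intros) auto

lemma sep_holomorphic_mult: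
  "sep_holomorphic B R F \<Longrightarrow> sep_holomorphic B R G \<Longrightarrow> sep_holomorphic B R (\<lambda>w. F w * G w)"
  unfolding sep_holomorphic_def by (intro ballI holomorphic_intros) auto

lemma sep_holomorphic_sum:
  "(\<And>i. i \<in> I \<Longrightarrow> sep_holomorphic B R (F i)) \<Longrightarrow> sep_holomorphic B R (\<lambda>w. \<Sum>i\<in>I. F i w)"
  unfolding sep_holomorphic_def by (intro ballI holomorphic_intros) auto

lemma sep_holomorphic_exp:
  "sep_holomorphic B R F \<Longrightarrow> sep_holomorphic B R (\<lambda>w. exp (F w))"
  unfolding sep_holomorphic_def by (intro ballI holomorphic_on_exp'[unfolded o_def] ) auto

lemmas sep_holomorphic_intros = sep_holomorphic_coordinate sep_holomorphic_const
  sep_holomorphic_add sep_holomorphic_diff sep_holomorphic_mult sep_holomorphic_sum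
  sep_holomorphic_exp

lemma polydisc_upd_same:
  assumes "w \<in> polydisc B R" "b \<in> B" "\<zeta> \<in> ball 0 R"
  shows "w(b := \<zeta>) \<in> polydisc B R"
  using polydisc_upd[OF assms(1), of \<zeta> b] assms by (simp add: insert_absorb)

lemma sep_holomorphic_integral:
  assumes "\<And>p. p \<in> space N \<Longrightarrow> sep_holomorphic B R (\<lambda>w. G w p)"
    and "\<And>w. w \<in> polydisc B R \<Longrightarrow> G w \<in> borel_measurable N"
    and "integrable N D"
    and bound: "AE p in N. \<forall>w\<in>polydisc B R. norm (G w p) \<le> D p"
  shows "sep_holomorphic B R (\<lambda>w. \<integral>p. G w p \<partial>N)"
  unfolding sep_holomorphic_def
proof (intro ballI)
  fix w b assume w: "w \<in> polydisc B R" "b \<in> B"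
  show "(\<lambda>\<zeta>. \<integral>p. G (w(b := \<zeta>)) p \<partial>N) holomorphic_on ball 0 R"
  proof (rule holomorphic_on_parameter_integral[where D=D])
    show "AE p in N. \<forall>\<zeta>\<in>ball 0 R. norm (G (w(b := \<zeta>)) p) \<le> D p"
      using bound by eventually_elim (use polydisc_upd_same[OF w] in blast)
  qed (use assms w polydisc_upd_same[OF w] in \<open>auto simp: sep_holomorphic_def\<close>)
qed

lemma (in finite_measure) norm_integral_le_mass:
  fixes f :: "'a \<Rightarrow> 'b::{banach, second_countable_topology}"
  assumes "AE p in M. norm (f p) \<le> c" "0 \<le> c"
  shows "norm (\<integral>p. f p \<partial>M) \<le> c * measure M (space M)"
proof (cases "integrable M f")
  case True
  have "norm (\<integral>p. f p \<partial>M) \<le> (\<integral>p. norm (f p) \<partial>M)" by simp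
  also have "\<dots> \<le> (\<integral>p. c \<partial>M)"
    by (rule integral_mono_AE) (use True assms in auto)
  finally show ?thesis by (simp add: mult.commute)
qed (use assms in \<open>simp add: not_integrable_integral_eq\<close>)

lemma holomorphically_extends_at_const: "holomorphically_extends_at (\<lambda>_. c) a"
  by (rule holomorphically_extends_atI[where R=1 and F="\<lambda>_. of_real c" and M="\<bar>c\<bar>"])
     (auto simp: sep_holomorphic_const)

lemma holomorphically_extends_at_inner:
  fixes b :: "'a::euclidean_space"
  assumes "b \<in> Basis"
  shows "holomorphically_extends_at (\<lambda>z. z \<bullet> b) a"
proof (rule holomorphically_extends_atI[where R=1 and F="\<lambda>w. of_real (a \<bullet> b) + w b" and M="\<bar>a \<bullet> b\<bar> + 1"])
  fix w :: "'a \<Rightarrow> complex" assume "w \<in> polydisc Basis 1"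
  then have "norm (w b) \<le> 1" using assms by (simp add: polydisc_def less_imp_le)
  then show "cmod (complex_of_real (a \<bullet> b) + w b) \<le> \<bar>a \<bullet> b\<bar> + 1"
    by (metis add_left_mono norm_of_real norm_triangle_le)
qed (use assms in \<open>auto simp: complexify_def inner_add_left intro!: sep_holomorphic_intros\<close>)

text \<open>Common part of the closure under sums and products: \<open>h\<close> is the complex operation, \<open>h'\<close> its real
  restriction, and \<open>k\<close> bounds the result in terms of bounds of the operands.\<close>

lemma holomorphically_extends_at_combine:
  fixes a :: "'a::euclidean_space"
  assumes "holomorphically_extends_at \<phi> a" "holomorphically_extends_at \<psi> a"
    and hol: "\<And>R (F :: ('a \<Rightarrow> complex) \<Rightarrow> complex) G. sep_holomorphic Basis R F \<Longrightarrow> sep_holomorphic Basis R G \<Longrightarrow>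
           sep_holomorphic Basis R (\<lambda>w. h (F w) (G w) :: complex)"
    and real: "\<And>x y. h (of_real x) (of_real y) = of_real (h' x y)"
    and bd: "\<And>x y M N. norm x \<le> M \<Longrightarrow> norm y \<le> N \<Longrightarrow> norm (h x y) \<le> k M N"
  shows "holomorphically_extends_at (\<lambda>z. h' (\<phi> z) (\<psi> z)) a"
proof -
  obtain R F M where R: "R > 0" and F: "sep_holomorphic Basis R F"
      "\<And>w. w \<in> polydisc Basis R \<Longrightarrow> norm (F w) \<le> M"
    and Fext: "\<And>z. complexify z \<in> polydisc Basis R \<Longrightarrow> F (complexify z) = complex_of_real (\<phi> (a + z))"
    using assms(1) unfolding holomorphically_extends_at_def by blast
  obtain R' G N where R': "R' > 0" and G: "sep_holomorphic Basis R' G"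
      "\<And>w. w \<in> polydisc Basis R' \<Longrightarrow> norm (G w) \<le> N"
    and Gext: "\<And>z. complexify z \<in> polydisc Basis R' \<Longrightarrow> G (complexify z) = complex_of_real (\<psi> (a + z))"
    using assms(2) unfolding holomorphically_extends_at_def by blast
  define r where "r = min R R'"
  have r: "r > 0" "r \<le> R" "r \<le> R'" using R R' by (auto simp: r_def)
  note sub = polydisc_mono[OF r(2), THEN subsetD] polydisc_mono[OF r(3), THEN subsetD]
  show ?thesis
  proof (rule holomorphically_extends_atI[where F="\<lambda>w. h (F w) (G w)" and M="k M N", OF r(1)])
    show "sep_holomorphic Basis r (\<lambda>w. h (F w) (G w))"
      by (rule hol[OF sep_holomorphic_subset[OF F(1) r(2)] sep_holomorphic_subset[OF G(1) r(3)]])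
    show "norm (h (F w) (G w)) \<le> k M N" if "w \<in> polydisc Basis r" for w
      by (rule bd[OF F(2)[OF sub(1)[OF that]] G(2)[OF sub(2)[OF that]]])
    show "h (F (complexify z)) (G (complexify z)) = complex_of_real (h' (\<phi> (a + z)) (\<psi> (a + z)))"
      if "complexify z \<in> polydisc Basis r" for z
      using Fext[OF sub(1)[OF that]] Gext[OF sub(2)[OF that]] real by simp
  qed
qed

lemma holomorphically_extends_at_add:
  assumes "holomorphically_extends_at \<phi> a" "holomorphically_extends_at \<psi> a"
  shows "holomorphically_extends_at (\<lambda>z. \<phi> z + \<psi> z) a"
  by (rule holomorphically_extends_at_combine[OF assms, where h="(+)" and k="(+)"])
     (auto intro: sep_holomorphic_add norm_triangle_mono)

lemma holomorphically_extends_at_mult: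
  assumes "holomorphically_extends_at \<phi> a" "holomorphically_extends_at \<psi> a"
  shows "holomorphically_extends_at (\<lambda>z. \<phi> z * \<psi> z) a"
  by (rule holomorphically_extends_at_combine[OF assms, where h="(*)" and k="(*)"])
     (auto intro: sep_holomorphic_mult simp: norm_mult intro!: mult_mono order_trans[OF norm_ge_zero])

lemma holomorphically_extends_at_sum:
  assumes "finite I" "\<And>i. i \<in> I \<Longrightarrow> holomorphically_extends_at (\<phi> i) a"
  shows "holomorphically_extends_at (\<lambda>z. \<Sum>i\<in>I. \<phi> i z) a"
  using assms
  by (induction rule: finite_induct)
     (auto intro: holomorphically_extends_at_const holomorphically_extends_at_add)

section \<open>Logarithms of exponential integrals\<close>

lemma norm_exp_minus_1_le:
  fixes z :: complex
  assumes "norm z \<le> 1"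
  shows "norm (exp z - 1) \<le> 3 * norm z"
proof -
  have "norm (exp z - exp 0) \<le> 3 * norm (z - 0)"
  proof (rule field_differentiable_bound[of "cball 0 1" exp exp])
    fix x :: complex assume "x \<in> cball 0 1"
    then have "norm (exp x) \<le> exp 1"
      by (intro order_trans[OF norm_exp]) auto
    then show "norm (exp x) \<le> 3" using exp_le by linarith
  qed (use assms in \<open>auto intro!: derivative_eq_intros\<close>)
  then show ?thesis by simp
qed

lemma norm_exp_diff_minus_diff_le:
  fixes s t :: complex
  assumes "norm s \<le> \<sigma>" "norm t \<le> \<sigma>" "\<sigma> \<le> 1"
  shows "norm ((exp s - exp t) - (s - t)) \<le> 3 * \<sigma> * norm (s - t)"
proof -
  have "norm ((exp s - s) - (exp t - t)) \<le> 3 * \<sigma> * norm (s - t)"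
  proof (rule field_differentiable_bound[of "cball 0 \<sigma>" "\<lambda>x. exp x - x" "\<lambda>x. exp x - 1"])
    fix x :: complex assume "x \<in> cball 0 \<sigma>"
    then show "norm (exp x - 1) \<le> 3 * \<sigma>"
      using norm_exp_minus_1_le[of x] assms by auto
  qed (use assms in \<open>auto intro!: derivative_eq_intros\<close>)
  then show ?thesis by (simp add: algebra_simps)
qed

text \<open>Since the exponents \<open>S\<close> are at most \<open>1 / 6\<close>, the integral of \<open>exp S\<close> stays within half the total mass
  of the total mass, hence in the domain of holomorphy of the principal logarithm.\<close>

lemma holomorphically_extends_at_log_integral_exp:
  fixes \<phi> :: "'a::euclidean_space \<Rightarrow> real"
  assumes "finite_measure N" and mass: "measure N (space N) > 0" and R: "R > 0"
    and hol: "\<And>p. p \<in> space N \<Longrightarrow> sep_holomorphic Basis R (\<lambda>w. S w p)"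
    and meas: "\<And>w. w \<in> polydisc Basis R \<Longrightarrow> S w \<in> borel_measurable N"
    and small: "AE p in N. \<forall>w\<in>polydisc Basis R. norm (S w p) \<le> 1 / 6"
    and real: "\<And>z p. complexify z \<in> polydisc Basis R \<Longrightarrow> p \<in> space N \<Longrightarrow>
        S (complexify z) p = complex_of_real (T z p)"
    and \<phi>: "\<And>z. complexify z \<in> polydisc Basis R \<Longrightarrow> \<phi> (a + z) = ln (\<integral>p. exp (T z p) \<partial>N)"
  shows "holomorphically_extends_at \<phi> a"
proof -
  interpret finite_measure N by fact
  define m where "m = measure N (space N)"
  have m: "m > 0" using mass by (simp add: m_def)
  define E where "E w = (\<integral>p. exp (S w p) \<partial>N)" for w
  have near1: "norm (exp s - 1) \<le> 1 / 2" if "norm s \<le> 1 / 6" for s :: complex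
    using norm_exp_minus_1_le[of s] that by simp
  have AEn: "AE p in N. \<forall>w\<in>polydisc Basis R. norm (exp (S w p) - 1) \<le> 1 / 2"
    using small by eventually_elim (use near1 in blast)
  have AEb: "AE p in N. \<forall>w\<in>polydisc Basis R. norm (exp (S w p)) \<le> 2"
    using AEn
  proof eventually_elim
    case (elim p)
    show ?case
    proof
      fix w :: "'a \<Rightarrow> complex" assume "w \<in> polydisc Basis R"
      with elim have "norm (exp (S w p) - 1) \<le> 1 / 2" by blast
      then show "norm (exp (S w p)) \<le> 2"
        using norm_triangle_ineq2[of "exp (S w p)" 1] by simp
    qed
  qed
  have measE: "(\<lambda>p. exp (S w p)) \<in> borel_measurable N" if "w \<in> polydisc Basis R" for w
    using meas[OF that] by measurable
  have Ehol: "sep_holomorphic Basis R E"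
    unfolding E_def
    by (rule sep_holomorphic_integral[where D="\<lambda>_. 2"])
       (use hol measE AEb in \<open>auto intro: sep_holomorphic_exp\<close>)
  have Enear: "E w \<in> cball (of_real m) (m / 2)" if w: "w \<in> polydisc Basis R" for w
  proof -
    have "integrable N (\<lambda>p. exp (S w p))"
      by (rule integrable_const_bound[where B=2]) (use AEb measE[OF w] w in \<open>auto elim!: eventually_mono\<close>)
    then have "E w - of_real m = (\<integral>p. exp (S w p) - 1 \<partial>N)"
      by (simp add: E_def m_def scaleR_conv_of_real)
    also have "norm \<dots> \<le> 1 / 2 * measure N (space N)"
      by (rule norm_integral_le_mass) (use AEn w in \<open>auto elim!: eventually_mono\<close>)
    finally show ?thesis
      by (simp add: m_def dist_norm norm_minus_commute)
  qed
  have Re_pos: "Re x > 0" if "x \<in> cball (complex_of_real m) (m / 2)" for x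
    using that m abs_Re_le_cmod[of "of_real m - x"] by (auto simp: dist_norm)
  have nonpos: "x \<notin> \<real>\<^sub>\<le>\<^sub>0" if "x \<in> cball (complex_of_real m) (m / 2)" for x
    using Re_pos[OF that] by (auto simp: complex_nonpos_Reals_iff)
  have "compact (Ln ` cball (of_real m) (m / 2))"
    by (intro compact_continuous_image continuous_on_Ln) (use nonpos in auto)
  then have "bounded (Ln ` cball (of_real m) (m / 2))"
    by (rule compact_imp_bounded)
  then obtain M where M: "\<And>x. x \<in> cball (of_real m) (m / 2) \<Longrightarrow> norm (Ln x) \<le> M"
    unfolding bounded_iff by blast
  show ?thesis
  proof (rule holomorphically_extends_atI[where F="\<lambda>w. Ln (E w)" and M=M, OF R])
    show "sep_holomorphic Basis R (\<lambda>w. Ln (E w))"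
      unfolding sep_holomorphic_def
    proof (intro ballI)
      fix w :: "'a \<Rightarrow> complex" and b assume w: "w \<in> polydisc Basis R" "b \<in> (Basis :: 'a set)"
      show "(\<lambda>\<zeta>. Ln (E (w(b := \<zeta>)))) holomorphic_on ball 0 R"
        by (rule holomorphic_on_Ln')
           (use w Ehol nonpos Enear polydisc_upd_same[OF w] in \<open>auto simp: sep_holomorphic_def\<close>)
    qed
    fix z :: 'a assume z: "complexify z \<in> polydisc Basis R"
    have "E (complexify z) = (\<integral>p. complex_of_real (exp (T z p)) \<partial>N)"
      unfolding E_def by (rule Bochner_Integration.integral_cong) (auto simp: real[OF z] exp_of_real)
    also have "\<dots> = complex_of_real (\<integral>p. exp (T z p) \<partial>N)"
      by (rule integral_complex_of_real)
    finally have eq: "E (complexify z) = complex_of_real (\<integral>p. exp (T z p) \<partial>N)" .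
    then have "(\<integral>p. exp (T z p) \<partial>N) > 0"
      using Re_pos[OF Enear[OF z]] by simp
    then show "Ln (E (complexify z)) = complex_of_real (\<phi> (a + z))"
      by (simp add: eq \<phi>[OF z] Ln_of_real)
  qed (use M Enear in auto)
qed

section \<open>A holomorphic implicit function\<close>

text \<open>The linear form \<open>v \<bullet> X p + w \<bullet> Y p\<close> with complex coefficients; the components of \<open>X p\<close> are indexed
  by a finite type, those of \<open>Y p\<close> by the canonical basis.\<close>

definition lin_exponent ::
  "('i::finite \<Rightarrow> 'p \<Rightarrow> real) \<Rightarrow> ('a::euclidean_space \<Rightarrow> 'p \<Rightarrow> real) \<Rightarrow> ('i \<Rightarrow> complex) \<Rightarrow> ('a \<Rightarrow> complex) \<Rightarrow> 'p \<Rightarrow> complex"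
where
  "lin_exponent X Y v w p = (\<Sum>i\<in>UNIV. v i * of_real (X i p)) + (\<Sum>b\<in>Basis. w b * of_real (Y b p))"

lemma norm_lin_exponent_le:
  fixes X :: "'i::finite \<Rightarrow> 'p \<Rightarrow> real" and Y :: "'a::euclidean_space \<Rightarrow> 'p \<Rightarrow> real"
  assumes "\<forall>i. \<bar>X i p\<bar> \<le> K" "\<forall>b\<in>Basis. \<bar>Y b p\<bar> \<le> K"
    and v: "\<And>i. norm (v i) \<le> \<rho>" and w: "\<And>b. b \<in> Basis \<Longrightarrow> norm (w b) \<le> \<tau>"
  shows "norm (lin_exponent X Y v w p) \<le> real CARD('i) * K * \<rho> + real DIM('a) * K * \<tau>"
proof -
  have \<rho>: "0 \<le> \<rho>" using v[of undefined] norm_ge_zero order_trans by blast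
  have \<tau>: "0 \<le> \<tau>" using w[OF SOME_Basis] norm_ge_zero order_trans by blast
  have "norm (\<Sum>i\<in>UNIV. v i * of_real (X i p)) \<le> (\<Sum>i\<in>(UNIV::'i set). K * \<rho>)"
    by (rule sum_norm_le)
       (use assms(1) v \<rho> in \<open>auto simp: norm_mult mult.commute[of K] intro!: mult_mono\<close>)
  moreover have "norm (\<Sum>b\<in>Basis. w b * of_real (Y b p)) \<le> (\<Sum>b\<in>(Basis::'a set). K * \<tau>)"
    by (rule sum_norm_le)
       (use assms(2) w \<tau> in \<open>auto simp: norm_mult mult.commute[of K] intro!: mult_mono\<close>)
  ultimately show ?thesis
    unfolding lin_exponent_def by (intro norm_triangle_le) (simp add: mult.assoc)
qed

lemma sep_holomorphic_lin_exponent: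
  assumes "\<And>i. sep_holomorphic B R (\<lambda>w. V w i)"
  shows "sep_holomorphic B R (\<lambda>w. lin_exponent X Y (V w) w p)"
  unfolding lin_exponent_def by (intro sep_holomorphic_intros assms)

lemma lin_exponent_measurable [measurable]:
  assumes "\<And>i. X i \<in> borel_measurable N" "\<And>b. b \<in> Basis \<Longrightarrow> Y b \<in> borel_measurable N"
  shows "lin_exponent X Y v w \<in> borel_measurable N"
proof -
  have [measurable]: "X i \<in> borel_measurable N" for i by (rule assms)
  have "(\<lambda>p. (\<Sum>b\<in>Basis. w b * of_real (Y b p))) \<in> borel_measurable N"
  proof (rule borel_measurable_sum)
    fix b :: 'c assume "b \<in> Basis"
    then have [measurable]: "Y b \<in> borel_measurable N" by (rule assms)
    show "(\<lambda>p. w b * of_real (Y b p)) \<in> borel_measurable N" by measurable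
  qed
  then have [measurable]: "(\<lambda>p. (\<Sum>b\<in>Basis. w b * of_real (Y b p))) \<in> borel_measurable N" .
  show ?thesis unfolding lin_exponent_def[abs_def] by measurable
qed

lemma sep_holomorphic_uniform_limit:
  assumes "\<And>k. sep_holomorphic B R (F k)"
    and lim: "uniform_limit (polydisc B R) F G sequentially"
  shows "sep_holomorphic B R G"
  unfolding sep_holomorphic_def
proof (intro ballI)
  fix w b assume w: "w \<in> polydisc B R" "b \<in> B"
  show "(\<lambda>\<zeta>. G (w(b := \<zeta>))) holomorphic_on ball 0 R"
  proof (rule holomorphic_uniform_sequence[OF open_ball])
    show "(\<lambda>\<zeta>. F k (w(b := \<zeta>))) holomorphic_on ball 0 R" for k
      using assms(1) w by (auto simp: sep_holomorphic_def)
    fix x :: complex assume "x \<in> ball 0 R"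
    then obtain d where d: "d > 0" "cball x d \<subseteq> ball 0 R"
      using open_contains_cball[of "ball (0::complex) R"] by blast
    have "uniform_limit (cball x d) (\<lambda>k \<zeta>. F k (w(b := \<zeta>))) (\<lambda>\<zeta>. G (w(b := \<zeta>))) sequentially"
      unfolding uniform_limit_iff
    proof (intro allI impI)
      fix e :: real assume "e > 0"
      with lim have "\<forall>\<^sub>F n in sequentially. \<forall>u\<in>polydisc B R. dist (F n u) (G u) < e"
        by (auto simp: uniform_limit_iff)
      then show "\<forall>\<^sub>F n in sequentially. \<forall>\<zeta>\<in>cball x d. dist (F n (w(b := \<zeta>))) (G (w(b := \<zeta>))) < e"
        by eventually_elim (use d polydisc_upd_same[OF w] in blast)
    qed
    with d show "\<exists>d>0. cball x d \<subseteq> ball 0 R \<and>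
        uniform_limit (cball x d) (\<lambda>k \<zeta>. F k (w(b := \<zeta>))) (\<lambda>\<zeta>. G (w(b := \<zeta>))) sequentially"
      by blast
  qed
qed

text \<open>The equations \<open>\<integral> \<beta> i p * exp (v \<bullet> X p + w \<bullet> Y p) dN = 0\<close> hold for \<open>v = 0\<close>, \<open>w = 0\<close>, and \<open>dual\<close> says
  that their derivative in \<open>v\<close> there is the identity. So \<open>T v w i = v i - \<integral> \<beta> i p * exp (v \<bullet> X p + w \<bullet> Y p) dN\<close>
  is a contraction in \<open>v\<close> near \<open>0\<close> for the maximum norm, and its fixed point is the limit of iterates that
  are separately holomorphic in \<open>w\<close>.\<close>

lemma implicit_holomorphic_solution:
  fixes X \<beta> :: "'i::finite \<Rightarrow> 'p \<Rightarrow> real" and Y :: "'a::euclidean_space \<Rightarrow> 'p \<Rightarrow> real"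
  assumes "finite_measure N"
    and X [measurable]: "\<And>i. X i \<in> borel_measurable N"
    and \<beta> [measurable]: "\<And>i. \<beta> i \<in> borel_measurable N"
    and Y: "\<And>b. b \<in> Basis \<Longrightarrow> Y b \<in> borel_measurable N"
    and K: "K > 0"
    and bdd: "AE p in N. (\<forall>i. \<bar>X i p\<bar> \<le> K) \<and> (\<forall>b\<in>Basis. \<bar>Y b p\<bar> \<le> K) \<and> (\<forall>i. \<bar>\<beta> i p\<bar> \<le> K)"
    and mean: "\<And>i. (\<integral>p. \<beta> i p \<partial>N) = 0"
    and dual: "\<And>i j. (\<integral>p. \<beta> i p * X j p \<partial>N) = (if i = j then 1 else 0)"
    and \<rho>0: "\<rho>0 > 0"
  shows "\<exists>r>0. r \<le> \<rho>0 \<and> (\<exists>V. (\<forall>i. sep_holomorphic Basis r (\<lambda>w. V w i)) \<and>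
     (\<forall>w\<in>polydisc Basis r. \<forall>i. norm (V w i) \<le> \<rho>0 \<and>
        (\<integral>p. of_real (\<beta> i p) * exp (lin_exponent X Y (V w) w p) \<partial>N) = 0) \<and>
     (\<forall>z. complexify z \<in> polydisc Basis r \<longrightarrow> (\<forall>i. V (complexify z) i \<in> \<real>)))"
proof -
  interpret finite_measure N by fact
  note [measurable] = lin_exponent_measurable[OF X Y]
  define m where "m = measure N (space N)"
  have m: "m \<ge> 0" by (simp add: m_def)
  define L where "L = (real CARD('i) + real DIM('a)) * K"
  have card: "real CARD('i) > 0" by simp
  have L: "L > 0" using K card unfolding L_def by (intro mult_pos_pos add_pos_nonneg) auto
  have cardL: "real CARD('i) * K \<le> L" "real DIM('a) * K \<le> L"
    using K by (auto simp: L_def algebra_simps)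
  \<comment> \<open>On the ball of radius \<open>\<rho>\<close> exponents are at most \<open>1\<close> and \<open>T\<close> contracts by \<open>1 / 2\<close> (fact \<open>contr\<close>); the smaller
    radius \<open>r\<close> for \<open>w\<close> makes the ball invariant under \<open>T\<close>.\<close>
  define \<rho> where "\<rho> = min \<rho>0 (min (1 / L) (1 / (6 * m * K * L\<^sup>2 + 1)))"
  have den: "6 * m * K * L\<^sup>2 + 1 > 0" using m K by (intro add_nonneg_pos mult_nonneg_nonneg) auto
  have \<rho>: "0 < \<rho>" "\<rho> \<le> \<rho>0" "L * \<rho> \<le> 1"
  proof -
    show "0 < \<rho>" using \<rho>0 L divide_pos_pos[OF zero_less_one den] by (simp add: \<rho>_def)
    have "L * \<rho> \<le> L * (1 / L)" using L by (intro mult_left_mono) (auto simp: \<rho>_def)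
    then show "L * \<rho> \<le> 1" using L by simp
  qed (simp add: \<rho>_def)
  have contr: "6 * m * K * L\<^sup>2 * \<rho> \<le> 1"
  proof -
    have "6 * m * K * L\<^sup>2 * \<rho> \<le> (6 * m * K * L\<^sup>2 + 1) * \<rho>"
      using \<rho> m K L by (intro mult_right_mono) auto
    also have "\<dots> \<le> (6 * m * K * L\<^sup>2 + 1) * (1 / (6 * m * K * L\<^sup>2 + 1))"
      using den by (intro mult_left_mono) (auto simp: \<rho>_def)
    also have "\<dots> = 1" using den by (subst times_divide_eq_right) (simp del: times_divide_eq_right)
    finally show ?thesis .
  qed
  define r where "r = \<rho> / (6 * m * K * L + 1)"
  have den2: "6 * m * K * L \<ge> 0" using m K L by simp
  have r: "0 < r" "r \<le> \<rho>" "6 * m * K * L * r \<le> \<rho>"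
  proof -
    show "0 < r" unfolding r_def by (rule divide_pos_pos) (use \<rho> den2 in linarith)+
    have nz: "6 * m * K * L + 1 \<noteq> 0" using den2 by linarith
    have *: "(6 * m * K * L + 1) * r = \<rho>"
      unfolding r_def times_divide_eq_right by (rule nonzero_mult_div_cancel_left[OF nz])
    moreover have "6 * m * K * L * r \<ge> 0" using den2 \<open>0 < r\<close> by simp
    ultimately show "r \<le> \<rho>" "6 * m * K * L * r \<le> \<rho>" using \<open>0 < r\<close> by (auto simp: algebra_simps)
  qed
  have wr: "norm (w b) \<le> r" if "w \<in> polydisc Basis r" "b \<in> Basis" for w and b :: 'a
    using that by (simp add: polydisc_def less_imp_le)
  have exp_bd: "norm (lin_exponent X Y v w p) \<le> L * \<rho>"
    if "\<forall>i. \<bar>X i p\<bar> \<le> K" "\<forall>b\<in>Basis. \<bar>Y b p\<bar> \<le> K" "\<And>i. norm (v i) \<le> \<rho>" "w \<in> polydisc Basis r"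
    for v w p
    using norm_lin_exponent_le[of X p K Y v \<rho> w \<rho>] that(1,2,3) wr[OF that(4)] r(2)
    by (force simp: L_def algebra_simps)
  have exp3: "norm (exp s) \<le> 3" if "norm s \<le> L * \<rho>" for s :: complex
  proof -
    have "norm (exp s) \<le> exp (norm s)" by (rule norm_exp)
    also have "\<dots> \<le> exp 1" using that \<rho> by simp
    finally show ?thesis using exp_le by linarith
  qed
  define G where "G i v w p = complex_of_real (\<beta> i p) * exp (lin_exponent X Y v w p)" for i v w p
  define T where "T v w i = v i - (\<integral>p. G i v w p \<partial>N)" for v w i
  have Gmeas [measurable]: "G i v w \<in> borel_measurable N" for i v w
    unfolding G_def by measurable
  have Gbd: "norm (G i v w p) \<le> K * 3"
    if "\<forall>i. \<bar>X i p\<bar> \<le> K" "\<forall>b\<in>Basis. \<bar>Y b p\<bar> \<le> K" "\<forall>i. \<bar>\<beta> i p\<bar> \<le> K" "\<And>i. norm (v i) \<le> \<rho>" "w \<in> polydisc Basis r"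
    for i v w p
    unfolding G_def norm_mult
    using exp3[OF exp_bd[OF that(1,2,4,5)]] that(3) K by (auto intro!: mult_mono)
  have Gint: "integrable N (G i v w)" if "\<And>i. norm (v i) \<le> \<rho>" "w \<in> polydisc Basis r" for i v w
  proof (rule integrable_const_bound[where B="K * 3"])
    show "AE p in N. norm (G i v w p) \<le> K * 3"
      using bdd by eventually_elim (use Gbd that in blast)
  qed measurable
  have \<beta>int: "integrable N (\<beta> i)" for i
  proof (rule integrable_const_bound[where B=K])
    show "AE p in N. norm (\<beta> i p) \<le> K"
      using bdd by eventually_elim simp
  qed measurable
  have \<beta>Xint: "integrable N (\<lambda>p. \<beta> i p * X j p)" for i j
  proof (rule integrable_const_bound[where B="K * K"])
    show "AE p in N. norm (\<beta> i p * X j p) \<le> K * K"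
      using bdd by eventually_elim (use K in \<open>auto simp: abs_mult intro!: mult_mono\<close>)
  qed measurable
  \<comment> \<open>By \<open>dual\<close>, the linear part of the exponential cancels the term \<open>v i\<close> of \<open>T\<close>; only
    \<open>exp s - exp t - (s - t)\<close>, for the two exponents \<open>s\<close> and \<open>t\<close>, contributes to the Lipschitz constant.\<close>
  have lin: "(\<integral>p. of_real (\<beta> i p) * (lin_exponent X Y v w p - lin_exponent X Y v' w p) \<partial>N) = v i - v' i"
    for i v v' w
  proof -
    have "of_real (\<beta> i p) * (lin_exponent X Y v w p - lin_exponent X Y v' w p) =
        (\<Sum>j\<in>UNIV. (v j - v' j) * complex_of_real (\<beta> i p * X j p))" for p
      by (simp add: lin_exponent_def algebra_simps sum_subtractf sum_distrib_left)
    then have "(\<integral>p. of_real (\<beta> i p) * (lin_exponent X Y v w p - lin_exponent X Y v' w p) \<partial>N) =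
        (\<integral>p. (\<Sum>j\<in>UNIV. (v j - v' j) * complex_of_real (\<beta> i p * X j p)) \<partial>N)"
      by presburger
    also have "\<dots> = (\<Sum>j\<in>UNIV. (\<integral>p. (v j - v' j) * complex_of_real (\<beta> i p * X j p) \<partial>N))"
      by (rule Bochner_Integration.integral_sum) (intro integrable_mult_right integrable_of_real \<beta>Xint)
    also have "\<dots> = (\<Sum>j\<in>UNIV. (v j - v' j) * complex_of_real (\<integral>p. \<beta> i p * X j p \<partial>N))"
      by (simp only: integral_mult_right_zero integral_complex_of_real)
    also have "\<dots> = (\<Sum>j\<in>UNIV. if i = j then v j - v' j else 0)"
      unfolding dual by (intro sum.cong) auto
    finally show ?thesis by simp
  qed
  have linint: "integrable N (\<lambda>p. of_real (\<beta> i p) * (lin_exponent X Y v w p - lin_exponent X Y v' w p))"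
    for i v v' w
  proof -
    have "of_real (\<beta> i p) * (lin_exponent X Y v w p - lin_exponent X Y v' w p) =
        (\<Sum>j\<in>UNIV. (v j - v' j) * complex_of_real (\<beta> i p * X j p))" for p
      by (simp add: lin_exponent_def algebra_simps sum_subtractf sum_distrib_left)
    then show ?thesis
      by (auto intro!: integrable_mult_right integrable_of_real \<beta>Xint simp del: of_real_mult)
  qed
  have Tlip: "norm (T v w i - T v' w i) \<le> \<delta> / 2"
    if v: "\<And>i. norm (v i) \<le> \<rho>" "\<And>i. norm (v' i) \<le> \<rho>" and \<delta>: "\<And>i. norm (v i - v' i) \<le> \<delta>"
      and w: "w \<in> polydisc Basis r" for v v' w \<delta> i
  proof -
    have \<delta>0: "\<delta> \<ge> 0" using \<delta>[of i] norm_ge_zero order_trans by blast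
    let ?S = "lin_exponent X Y v w" and ?S' = "lin_exponent X Y v' w"
    have "T v w i - T v' w i = (\<integral>p. of_real (\<beta> i p) * (?S p - ?S' p) \<partial>N) -
        ((\<integral>p. G i v w p \<partial>N) - (\<integral>p. G i v' w p \<partial>N))"
      unfolding lin by (simp add: T_def)
    also have "\<dots> = (\<integral>p. of_real (\<beta> i p) * (?S p - ?S' p) - (G i v w p - G i v' w p) \<partial>N)"
      using linint Gint[of v w i] Gint[of v' w i] v w by (simp del: of_real_mult)
    also have "norm \<dots> \<le> K * (3 * (L * \<rho>) * (L * \<delta>)) * measure N (space N)"
    proof (rule norm_integral_le_mass)
      show "AE p in N. norm (of_real (\<beta> i p) * (?S p - ?S' p) - (G i v w p - G i v' w p)) \<le> K * (3 * (L * \<rho>) * (L * \<delta>))"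
        using bdd
      proof eventually_elim
        case (elim p)
        have "?S p - ?S' p = lin_exponent X Y (\<lambda>i. v i - v' i) (\<lambda>_. 0) p"
          by (simp add: lin_exponent_def algebra_simps sum_subtractf)
        also have "norm \<dots> \<le> real CARD('i) * K * \<delta> + real DIM('a) * K * 0"
          by (rule norm_lin_exponent_le) (use elim \<delta> in auto)
        also have "\<dots> \<le> L * \<delta>" using cardL \<delta>0 by (simp add: mult_right_mono)
        finally have d: "norm (?S p - ?S' p) \<le> L * \<delta>" .
        have "norm ((exp (?S p) - exp (?S' p)) - (?S p - ?S' p)) \<le> 3 * (L * \<rho>) * norm (?S p - ?S' p)"
          by (rule norm_exp_diff_minus_diff_le) (use exp_bd elim v w \<rho> in auto)
        also have "\<dots> \<le> 3 * (L * \<rho>) * (L * \<delta>)"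
          by (rule mult_left_mono[OF d]) (use L \<rho> in auto)
        finally have e: "norm ((?S p - ?S' p) - (exp (?S p) - exp (?S' p))) \<le> 3 * (L * \<rho>) * (L * \<delta>)"
          by (simp add: norm_minus_commute)
        have "of_real (\<beta> i p) * (?S p - ?S' p) - (G i v w p - G i v' w p) =
            of_real (\<beta> i p) * ((?S p - ?S' p) - (exp (?S p) - exp (?S' p)))"
          by (simp add: G_def algebra_simps)
        also have "norm \<dots> \<le> K * (3 * (L * \<rho>) * (L * \<delta>))"
          unfolding norm_mult by (rule mult_mono[OF _ e]) (use elim K in auto)
        finally show ?case .
      qed
    qed (use K L \<rho> \<delta>0 in auto)
    also have "\<dots> = (6 * m * K * L\<^sup>2 * \<rho>) * \<delta> / 2"
      by (simp add: m_def power2_eq_square algebra_simps)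
    also have "\<dots> \<le> 1 * \<delta> / 2"
      using contr \<delta>0 by (intro divide_right_mono mult_right_mono) auto
    finally show ?thesis by simp
  qed
  have T0: "norm (T (\<lambda>_. 0) w i) \<le> \<rho> / 2" if w: "w \<in> polydisc Basis r" for w i
  proof -
    let ?S = "lin_exponent X Y (\<lambda>_. 0) w"
    have "(\<integral>p. G i (\<lambda>_. 0) w p - of_real (\<beta> i p) \<partial>N) = (\<integral>p. G i (\<lambda>_. 0) w p \<partial>N) - of_real (\<integral>p. \<beta> i p \<partial>N)"
      using Gint[of "\<lambda>_. 0" w i] \<beta>int[of i] w \<rho> by (simp add: integral_complex_of_real)
    then have "norm (T (\<lambda>_. 0) w i) = norm (\<integral>p. G i (\<lambda>_. 0) w p - of_real (\<beta> i p) \<partial>N)"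
      by (simp add: T_def mean)
    also have "\<dots> \<le> K * (3 * (L * r)) * measure N (space N)"
    proof (rule norm_integral_le_mass)
      show "AE p in N. norm (G i (\<lambda>_. 0) w p - of_real (\<beta> i p)) \<le> K * (3 * (L * r))"
        using bdd
      proof eventually_elim
        case (elim p)
        have "norm (?S p) \<le> real CARD('i) * K * 0 + real DIM('a) * K * r"
          by (rule norm_lin_exponent_le) (use elim wr[OF w] in auto)
        also have "\<dots> \<le> L * r" using cardL r by (simp add: mult_right_mono)
        finally have a: "norm (?S p) \<le> L * r" .
        also have "L * r \<le> L * \<rho>" using L r by simp
        finally have "norm (?S p) \<le> 1" using \<rho> by simp
        then have "norm (exp (?S p) - 1) \<le> 3 * (L * r)"
          using norm_exp_minus_1_le[of "?S p"] a by linarith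
        then have "norm (of_real (\<beta> i p) * (exp (?S p) - 1)) \<le> K * (3 * (L * r))"
          unfolding norm_mult by (intro mult_mono) (use elim K in auto)
        then show ?case by (simp add: G_def algebra_simps)
      qed
    qed (use K L r in auto)
    also have "\<dots> = 6 * m * K * L * r / 2" by (simp add: m_def)
    also have "\<dots> \<le> \<rho> / 2" using r(3) by (rule divide_right_mono) simp
    finally show ?thesis .
  qed
  have Tself: "norm (T v w i) \<le> \<rho>" if v: "\<And>i. norm (v i) \<le> \<rho>" and w: "w \<in> polydisc Basis r" for v w i
  proof -
    have "norm (T v w i - T (\<lambda>_. 0) w i) \<le> \<rho> / 2"
      by (rule Tlip) (use v w \<rho> in auto)
    then show ?thesis using T0[OF w, of i] norm_triangle_sub[of "T v w i" "T (\<lambda>_. 0) w i"] by simp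
  qed
  define V where "V k w = ((\<lambda>v. T v w) ^^ k) (\<lambda>_. 0)" for k w
  have V0: "V 0 w = (\<lambda>_. 0)" and VS: "V (Suc k) w = T (V k w) w" for k w
    by (simp_all add: V_def)
  have Vbd: "norm (V k w i) \<le> \<rho>" if w: "w \<in> polydisc Basis r" for k w i
  proof (induction k arbitrary: i)
    case 0 then show ?case using \<rho> by (simp add: V0)
  next
    case (Suc k) then show ?case unfolding VS by (intro Tself w)
  qed
  have Vdiff: "norm (V (Suc k) w i - V k w i) \<le> \<rho> * (1 / 2) ^ k" if w: "w \<in> polydisc Basis r" for k w i
  proof (induction k arbitrary: i)
    case 0 then show ?case using Vbd[OF w, of 1 i] by (simp add: V0)
  next
    case (Suc k)
    have "norm (T (V (Suc k) w) w i - T (V k w) w i) \<le> (\<rho> * (1 / 2) ^ k) / 2"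
      by (rule Tlip[OF Vbd[OF w] Vbd[OF w] Suc.IH w])
    then show ?case unfolding VS[symmetric] by simp
  qed
  define W where "W w i = (\<Sum>k. V (Suc k) w i - V k w i)" for w i
  have unif: "uniform_limit (polydisc Basis r) (\<lambda>k w. V k w i) (\<lambda>w. W w i) sequentially" for i
  proof -
    have "uniform_limit (polydisc Basis r) (\<lambda>n w. \<Sum>k<n. V (Suc k) w i - V k w i) (\<lambda>w. W w i) sequentially"
      unfolding W_def
      by (rule Weierstrass_m_test[where M="\<lambda>k. \<rho> * (1 / 2) ^ k"])
         (use Vdiff in \<open>auto intro!: summable_mult summable_geometric\<close>)
    moreover have "(\<Sum>k<n. V (Suc k) w i - V k w i) = V n w i" for n w
      using sum_lessThan_telescope[of "\<lambda>k. V k w i" n] by (simp add: V0)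
    ultimately show ?thesis by simp
  qed
  have lim: "(\<lambda>k. V k w i) \<longlonglongrightarrow> W w i" if "w \<in> polydisc Basis r" for w i
    using tendsto_uniform_limitI[OF unif that] .
  have Wbd: "norm (W w i) \<le> \<rho>" if "w \<in> polydisc Basis r" for w i
    using Vbd[OF that] by (intro Lim_bounded[OF tendsto_norm[OF lim[OF that]], where M=0]) blast
  have fix_W: "T (W w) w i = W w i" if w: "w \<in> polydisc Basis r" for w i
  proof -
    have "(\<lambda>k. V (Suc k) w i) \<longlonglongrightarrow> T (W w) w i"
      unfolding tendsto_iff
    proof (intro allI impI)
      fix e :: real assume e: "e > 0"
      have "\<forall>\<^sub>F k in sequentially. dist (V k w j) (W w j) < e" for j
        using lim[OF w] e by (auto simp: tendsto_iff)
      then have "\<forall>\<^sub>F k in sequentially. \<forall>j. dist (V k w j) (W w j) < e"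
        by (rule eventually_all_finite)
      then show "\<forall>\<^sub>F k in sequentially. dist (V (Suc k) w i) (T (W w) w i) < e"
      proof eventually_elim
        case (elim k)
        have "norm (T (V k w) w i - T (W w) w i) \<le> e / 2"
          by (rule Tlip[OF Vbd[OF w] Wbd[OF w] _ w])
             (use elim in \<open>auto simp: dist_norm less_imp_le\<close>)
        then show ?case using e by (simp add: VS dist_norm)
      qed
    qed
    then show ?thesis using LIMSEQ_unique LIMSEQ_Suc[OF lim[OF w]] by blast
  qed
  have Vhol: "sep_holomorphic Basis r (\<lambda>w. V k w i)" for k i
  proof (induction k arbitrary: i)
    case 0 then show ?case by (simp add: V0 sep_holomorphic_const)
  next
    case (Suc k)
    show ?case unfolding VS T_def
    proof (intro sep_holomorphic_diff Suc.IH sep_holomorphic_integral[where D="\<lambda>_. K * 3"])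
      show "sep_holomorphic Basis r (\<lambda>w. G i (V k w) w p)" for p
        unfolding G_def by (intro sep_holomorphic_intros sep_holomorphic_lin_exponent Suc.IH)
      show "AE p in N. \<forall>w\<in>polydisc Basis r. norm (G i (V k w) w p) \<le> K * 3"
        using bdd by eventually_elim (use Gbd Vbd in blast)
    qed auto
  qed
  have exp_Reals: "exp x \<in> \<real>" if "x \<in> \<real>" for x :: complex
    using that by (metis Reals_cases Reals_of_real exp_of_real)
  have Vreal: "V k (complexify z) i \<in> \<real>" for k i and z :: 'a
  proof (induction k arbitrary: i)
    case 0 then show ?case by (simp add: V0)
  next
    case (Suc k)
    have "G i (V k (complexify z)) (complexify z) p \<in> \<real>" for p
      unfolding G_def lin_exponent_def
      by (intro Reals_mult Reals_of_real exp_Reals sum_in_Reals Reals_add Suc.IH) (auto simp: complexify_def)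
    then have "G i (V k (complexify z)) (complexify z) p = of_real (Re (G i (V k (complexify z)) (complexify z) p))" for p
      by simp
    then have "(\<integral>p. G i (V k (complexify z)) (complexify z) p \<partial>N) =
        (\<integral>p. complex_of_real (Re (G i (V k (complexify z)) (complexify z) p)) \<partial>N)"
      by presburger
    then have "(\<integral>p. G i (V k (complexify z)) (complexify z) p \<partial>N) \<in> \<real>"
      by (simp only: integral_complex_of_real Reals_of_real)
    then show ?case unfolding VS T_def using Suc.IH by (intro Reals_diff)
  qed
  show ?thesis
  proof (intro exI[of _ r] exI[of _ W] conjI allI ballI impI)
    show "sep_holomorphic Basis r (\<lambda>w. W w i)" for i
      by (rule sep_holomorphic_uniform_limit[OF Vhol unif])
    show "norm (W w i) \<le> \<rho>0" if "w \<in> polydisc Basis r" for w i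
      using Wbd[OF that, of i] \<rho> by linarith
    show "(\<integral>p. of_real (\<beta> i p) * exp (lin_exponent X Y (W w) w p) \<partial>N) = 0"
      if "w \<in> polydisc Basis r" for w i
      using fix_W[OF that, of i] by (simp add: T_def G_def)
    show "W (complexify z) i \<in> \<real>" if "complexify z \<in> polydisc Basis r" for z i
      by (rule Lim_in_closed_set[OF closed_complex_Reals _ _ lim[OF that]]) (use Vreal in auto)
  qed (use r \<rho> in auto)
qed

section \<open>Local boundedness and supports of measures\<close>

lemma holomorphically_extends_at_shift:
  "holomorphically_extends_at (\<lambda>u. \<phi> (u - a)) a \<longleftrightarrow> holomorphically_extends_at \<phi> 0"
  by (simp add: holomorphically_extends_at_def)

lemma holomorphically_extends_at_locally_bounded:
  fixes \<phi> :: "'a::euclidean_space \<Rightarrow> real"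
  assumes "holomorphically_extends_at \<phi> a"
  shows "\<exists>r>0. \<exists>B. \<forall>u\<in>ball a r. \<bar>\<phi> u\<bar> \<le> B"
proof -
  obtain R F M where R: "R > 0" and F: "\<And>w. w \<in> polydisc Basis R \<Longrightarrow> norm (F w) \<le> M"
    and ext: "\<And>z. complexify z \<in> polydisc Basis R \<Longrightarrow> F (complexify z) = complex_of_real (\<phi> (a + z))"
    using assms unfolding holomorphically_extends_at_def by blast
  have "\<bar>\<phi> u\<bar> \<le> M" if u: "u \<in> ball a R" for u
  proof -
    have "complexify (u - a) \<in> polydisc Basis R"
      unfolding complexify_in_polydisc_iff
    proof
      fix b :: 'a assume "b \<in> Basis"
      then show "\<bar>(u - a) \<bullet> b\<bar> < R"
        using Basis_le_norm[of b "u - a"] u by (simp add: dist_norm norm_minus_commute)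
    qed
    then show ?thesis using F[of "complexify (u - a)"] ext[of "u - a"] by simp
  qed
  with R show ?thesis by blast
qed

lemma compact_bounded_if_locally_bounded:
  fixes \<phi> :: "'a::metric_space \<Rightarrow> real"
  assumes "compact K" and "\<And>a. a \<in> K \<Longrightarrow> \<exists>r>0. \<exists>B. \<forall>u\<in>ball a r. \<bar>\<phi> u\<bar> \<le> B"
  shows "\<exists>B. \<forall>u\<in>K. \<bar>\<phi> u\<bar> \<le> B"
proof -
  have "\<forall>a\<in>K. \<exists>r B. r > 0 \<and> (\<forall>u\<in>ball a r. \<bar>\<phi> u\<bar> \<le> B)" using assms(2) by blast
  then obtain r B where rB: "\<And>a. a \<in> K \<Longrightarrow> r a > 0" "\<And>a u. a \<in> K \<Longrightarrow> u \<in> ball a (r a) \<Longrightarrow> \<bar>\<phi> u\<bar> \<le> B a"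
    by metis
  obtain C where C: "C \<subseteq> K" "finite C" "K \<subseteq> (\<Union>a\<in>C. ball a (r a))"
    by (rule compactE_image[OF assms(1), of K "\<lambda>a. ball a (r a)"]) (use rB(1) in force)+
  have "\<bar>\<phi> u\<bar> \<le> (\<Sum>a\<in>C. \<bar>B a\<bar>)" if u: "u \<in> K" for u
  proof -
    obtain a where a: "a \<in> C" "u \<in> ball a (r a)" using C(3) u by blast
    then have "\<bar>\<phi> u\<bar> \<le> \<bar>B a\<bar>" using rB(2)[of a u] C by force
    also have "\<dots> \<le> (\<Sum>a\<in>C. \<bar>B a\<bar>)" by (rule member_le_sum) (use a C in auto)
    finally show ?thesis .
  qed
  then show ?thesis by blast
qed

lemma AE_in_measure_support:
  fixes M :: "'a::second_countable_topology measure"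
  assumes "sets M = sets borel"
  shows "AE x in M. x \<in> measure_support M"
proof -
  define \<F> where "\<F> = {U. open U \<and> emeasure M U = 0}"
  obtain \<F>' where \<F>': "\<F>' \<subseteq> \<F>" "countable \<F>'" "\<Union>\<F>' = \<Union>\<F>"
    using Lindelof[of \<F>] by (auto simp: \<F>_def)
  have "(\<Union>U\<in>\<F>'. U) \<in> null_sets M"
    by (rule null_sets_UN') (use \<F>'(1,2) assms in \<open>auto simp: \<F>_def null_sets_def\<close>)
  moreover have "x \<in> (\<Union>U\<in>\<F>'. U)" if "x \<notin> measure_support M" for x
  proof -
    have "x \<in> \<Union>\<F>" using that by (auto simp: measure_support_def \<F>_def zero_less_iff_neq_zero)
    then show ?thesis using \<F>'(3) by simp
  qed
  ultimately show ?thesis by (intro AE_I[where N="\<Union>U\<in>\<F>'. U"]) auto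
qed

lemma AE_norm_bounded_if_compact_support:
  fixes X :: "'w \<Rightarrow> 'a::euclidean_space"
  assumes X: "X \<in> borel_measurable M" and "compact (measure_support (distr M borel X))"
  shows "\<exists>B. AE \<omega> in M. norm (X \<omega>) \<le> B"
proof -
  obtain B where B: "\<And>x. x \<in> measure_support (distr M borel X) \<Longrightarrow> norm x \<le> B"
    using compact_imp_bounded[OF assms(2)] unfolding bounded_iff by blast
  have "AE x in distr M borel X. x \<in> measure_support (distr M borel X)"
    by (rule AE_in_measure_support) simp
  then have "AE x in distr M borel X. norm x \<le> B"
    by eventually_elim (rule B)
  then show ?thesis by (subst (asm) AE_distr_iff[OF X]) auto
qed

lemma (in prob_space) integral_exp_pos:
  assumes "integrable M (\<lambda>p. exp (w p :: real))"
  shows "(\<integral>p. exp (w p) \<partial>M) > 0"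
proof -
  have "(\<integral>p. exp (w p) \<partial>M) \<noteq> 0"
    using integral_nonneg_eq_0_iff_AE[OF assms] by simp
  moreover have "(\<integral>p. exp (w p) \<partial>M) \<ge> 0" by (simp add: integral_nonneg_AE)
  ultimately show ?thesis by linarith
qed

section \<open>Exponentially tilted measures\<close>

lemma integral_exp_tilted:
  fixes f :: "'p \<Rightarrow> 'b::{banach, second_countable_topology}"
  assumes "w \<in> borel_measurable P" "f \<in> borel_measurable P"
  shows "(\<integral>p. f p \<partial>density P (\<lambda>p. ennreal (exp (w p)))) = (\<integral>p. exp (w p) *\<^sub>R f p \<partial>P)"
  by (rule integral_density) (use assms in auto)

lemma AE_exp_tilted:
  assumes "w \<in> borel_measurable P"
  shows "(AE p in density P (\<lambda>p. ennreal (exp (w p))). Q p) \<longleftrightarrow> (AE p in P. Q p)"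
  by (subst AE_density) (use assms in auto)

lemma (in prob_space) exp_tilted_measure:
  assumes w: "w \<in> borel_measurable M" and int: "integrable M (\<lambda>p. exp (w p :: real))"
  defines "N \<equiv> density M (\<lambda>p. ennreal (exp (w p)))"
  shows "finite_measure N" "measure N (space N) > 0"
proof -
  have "emeasure N (space N) = (\<integral>\<^sup>+p. ennreal (exp (w p)) \<partial>M)"
    unfolding N_def using w by (subst emeasure_density) (auto intro!: nn_integral_cong)
  also have "\<dots> = ennreal (\<integral>p. exp (w p) \<partial>M)"
    by (rule nn_integral_eq_integral[OF int]) simp
  finally have e: "emeasure N (space N) = ennreal (\<integral>p. exp (w p) \<partial>M)" .
  then show "finite_measure N" by (intro finite_measureI) simp
  show "measure N (space N) > 0"
    unfolding measure_def e using integral_exp_pos[OF int] by simp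
qed

lemma holomorphically_extends_at_log_laplace:
  fixes P :: "'p \<Rightarrow> 'a::euclidean_space"
  assumes N: "finite_measure N" "measure N (space N) > 0"
    and P: "P \<in> borel_measurable N" and bdd: "AE p in N. norm (P p) \<le> K"
  shows "holomorphically_extends_at (\<lambda>z. ln (\<integral>p. exp (z \<bullet> P p) \<partial>N)) 0"
proof -
  define K' where "K' = \<bar>K\<bar> + 1"
  have K': "K' > 0" by (simp add: K'_def)
  define R where "R = 1 / (6 * real DIM('a) * K')"
  have R: "R > 0" using K' by (simp add: R_def)
  have RK: "real DIM('a) * K' * R = 1 / 6"
    using K' by (simp add: R_def field_simps)
  \<comment> \<open>There is no first block of variables here, so it is indexed by \<open>unit\<close> and set to \<open>0\<close>.\<close>
  let ?X = "\<lambda>(_::unit) (_::'p). 0::real" and ?Y = "\<lambda>b p. P p \<bullet> b"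
  show ?thesis
  proof (rule holomorphically_extends_at_log_integral_exp[where T="\<lambda>z p. z \<bullet> P p", OF N R])
    show "sep_holomorphic Basis R (\<lambda>w. lin_exponent ?X ?Y (\<lambda>_. 0) w p)" for p
      by (rule sep_holomorphic_lin_exponent) (rule sep_holomorphic_const)
    show "lin_exponent ?X ?Y (\<lambda>_. 0) w \<in> borel_measurable N" for w
      by (rule lin_exponent_measurable) (use P in auto)
    show "AE p in N. \<forall>w\<in>polydisc Basis R. norm (lin_exponent ?X ?Y (\<lambda>_. 0) w p) \<le> 1 / 6"
      using bdd
    proof eventually_elim
      case (elim p)
      show ?case
      proof
        fix w :: "'a \<Rightarrow> complex" assume "w \<in> polydisc Basis R"
        then have w: "norm (w b) \<le> R" if "b \<in> Basis" for b
          using that by (simp add: polydisc_def less_imp_le)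
        have "\<bar>P p \<bullet> b\<bar> \<le> K'" if "b \<in> Basis" for b
          using Basis_le_norm[OF that, of "P p"] elim by (simp add: K'_def)
        then have "norm (lin_exponent ?X ?Y (\<lambda>_. 0) w p) \<le> real CARD(unit) * K' * 0 + real DIM('a) * K' * R"
          by (intro norm_lin_exponent_le) (use w K' in auto)
        then show "norm (lin_exponent ?X ?Y (\<lambda>_. 0) w p) \<le> 1 / 6" using RK by simp
      qed
    qed
    show "lin_exponent ?X ?Y (\<lambda>_. 0) (complexify z) p = complex_of_real (z \<bullet> P p)" for z p
      by (simp add: lin_exponent_def complexify_Basis euclidean_inner[of z "P p"])
  qed simp
qed

text \<open>Here \<open>\<delta> z\<close> is a critical point of the strictly convex function
  \<open>v \<mapsto> \<integral> exp (v \<bullet> X p + z \<bullet> Y p) dN\<close>. Multiplying \<open>X\<close> by the inverse of the Hessian at the origin gives the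
  functions \<open>\<beta>\<close> needed for the implicit function. No continuity of \<open>\<delta>\<close> is assumed: uniqueness of the
  critical point, which is global, identifies \<open>\<delta>\<close> with the local solution.\<close>

lemma tilted_critical_point_holomorphic:
  fixes X :: "'p \<Rightarrow> real ^ 'i" and Y :: "'p \<Rightarrow> 'a::euclidean_space" and \<delta> :: "'a \<Rightarrow> real ^ 'i"
  assumes N: "finite_measure N" "measure N (space N) > 0"
    and X [measurable]: "X \<in> borel_measurable N" and Y [measurable]: "Y \<in> borel_measurable N"
    and bdd: "AE p in N. norm (X p) \<le> K \<and> norm (Y p) \<le> K"
    and nondeg: "\<And>c. (AE p in N. c \<bullet> X p = 0) \<Longrightarrow> c = 0"
    and \<delta>0: "\<delta> 0 = 0"
    and crit: "\<And>z. (\<integral>p. exp (\<delta> z \<bullet> X p + z \<bullet> Y p) *\<^sub>R X p \<partial>N) = 0"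
  shows "holomorphically_extends_at (\<lambda>z. \<delta> z $ i) 0"
    and "holomorphically_extends_at (\<lambda>z. ln (\<integral>p. exp (\<delta> z \<bullet> X p + z \<bullet> Y p) \<partial>N)) 0"
proof -
  interpret finite_measure N by fact
  have compm [measurable]: "(\<lambda>p. X p $ j) \<in> borel_measurable N" for j
  proof -
    have "(\<lambda>p. X p \<bullet> axis j 1) \<in> borel_measurable N" by measurable
    then show ?thesis by (simp add: inner_axis)
  qed
  have XX: "AE p in N. \<forall>j. \<bar>X p $ j\<bar> \<le> K"
    using bdd by eventually_elim (meson component_le_norm_cart order_trans)
  have intXX: "integrable N (\<lambda>p. X p $ j * X p $ k)" for j k
  proof (rule integrable_const_bound[where B="K * K"])
    show "AE p in N. norm (X p $ j * X p $ k) \<le> K * K"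
      using XX by eventually_elim (auto simp: abs_mult intro!: mult_mono order_trans[OF abs_ge_zero])
  qed measurable
  \<comment> \<open>The Hessian in \<open>v\<close> at \<open>v = 0\<close>, \<open>z = 0\<close>.\<close>
  define H :: "real ^ 'i ^ 'i" where "H = (\<chi> j k. \<integral>p. X p $ j * X p $ k \<partial>N)"
  have "c = 0" if c: "H *v c = 0" for c
  proof -
    have "(c \<bullet> X p)\<^sup>2 = (\<Sum>j\<in>UNIV. \<Sum>k\<in>UNIV. c $ j * c $ k * (X p $ j * X p $ k))" for p
      by (simp add: inner_vec_def power2_eq_square sum_product mult_ac)
    then have eq: "(\<lambda>p. (c \<bullet> X p)\<^sup>2) = (\<lambda>p. \<Sum>j\<in>UNIV. \<Sum>k\<in>UNIV. c $ j * c $ k * (X p $ j * X p $ k))"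
      by blast
    have int: "integrable N (\<lambda>p. (c \<bullet> X p)\<^sup>2)"
      unfolding eq by (intro Bochner_Integration.integrable_sum integrable_mult_right intXX)
    have "(\<integral>p. (c \<bullet> X p)\<^sup>2 \<partial>N) = (\<Sum>j\<in>UNIV. \<Sum>k\<in>UNIV. c $ j * c $ k * H $ j $ k)"
      unfolding eq using intXX by (simp add: H_def)
    also have "\<dots> = c \<bullet> (H *v c)"
      by (simp add: inner_vec_def matrix_vector_mult_def sum_distrib_left mult_ac)
    finally have "(\<integral>p. (c \<bullet> X p)\<^sup>2 \<partial>N) = 0" using c by simp
    then have "AE p in N. (c \<bullet> X p)\<^sup>2 = 0"
      using integral_nonneg_eq_0_iff_AE[OF int] by simp
    then show ?thesis by (intro nondeg) simp
  qed
  then obtain A where A: "A ** H = mat 1"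
    using matrix_left_invertible_ker[of H] by blast
  then have HA: "H ** A = mat 1" by (simp add: matrix_left_right_inverse)
  define \<beta> where "\<beta> j p = (A *v X p) $ j" for j p
  have \<beta>eq: "\<beta> j p = (\<Sum>k\<in>UNIV. A $ j $ k * X p $ k)" for j p
    by (simp add: \<beta>_def matrix_vector_mult_def)
  have \<beta>m [measurable]: "\<beta> j \<in> borel_measurable N" for j
    unfolding \<beta>eq[abs_def] by measurable
  define KA where "KA = (\<Sum>j\<in>UNIV. \<Sum>k\<in>UNIV. \<bar>A $ j $ k\<bar>)"
  have KA: "KA \<ge> 0" by (auto simp: KA_def intro!: sum_nonneg)
  define K' where "K' = \<bar>K\<bar> + KA * \<bar>K\<bar> + 1"
  have K': "K' > 0" "K \<le> K'" "KA * \<bar>K\<bar> \<le> K'"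
    using mult_nonneg_nonneg[OF KA abs_ge_zero[of K]] by (auto simp: K'_def)
  have bound: "AE p in N. (\<forall>j. \<bar>X p $ j\<bar> \<le> K') \<and> (\<forall>b\<in>Basis. \<bar>Y p \<bullet> b\<bar> \<le> K') \<and> (\<forall>j. \<bar>\<beta> j p\<bar> \<le> K')"
    using bdd XX
  proof eventually_elim
    case (elim p)
    have "\<bar>Y p \<bullet> b\<bar> \<le> K'" if "b \<in> Basis" for b
      using Basis_le_norm[OF that, of "Y p"] elim K' by linarith
    moreover have "\<bar>\<beta> j p\<bar> \<le> K'" for j
    proof -
      have "\<bar>\<beta> j p\<bar> \<le> (\<Sum>k\<in>UNIV. \<bar>A $ j $ k\<bar> * \<bar>K\<bar>)"
        unfolding \<beta>eq
      proof (intro order_trans[OF sum_abs] sum_mono)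
        fix k
        have "\<bar>X p $ k\<bar> \<le> \<bar>K\<bar>" using elim(2) abs_ge_self order_trans by blast
        then show "\<bar>A $ j $ k * X p $ k\<bar> \<le> \<bar>A $ j $ k\<bar> * \<bar>K\<bar>"
          by (simp add: abs_mult mult_left_mono)
      qed
      also have "\<dots> = (\<Sum>k\<in>UNIV. \<bar>A $ j $ k\<bar>) * \<bar>K\<bar>" by (simp add: sum_distrib_right)
      also have "\<dots> \<le> KA * \<bar>K\<bar>"
      proof (rule mult_right_mono)
        show "(\<Sum>k\<in>UNIV. \<bar>A $ j $ k\<bar>) \<le> KA"
          unfolding KA_def
          by (rule member_le_sum[where f="\<lambda>j. \<Sum>k\<in>UNIV. \<bar>A $ j $ k\<bar>"]) (auto intro: sum_nonneg)
      qed simp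
      finally show ?thesis using K' by linarith
    qed
    moreover have "\<bar>X p $ j\<bar> \<le> K'" for j using elim(2) K'(2) order_trans by blast
    ultimately show ?case by blast
  qed
  have intX: "integrable N (\<lambda>p. X p $ j)" for j
    by (rule integrable_const_bound[where B=K]) (use XX in \<open>auto elim: eventually_mono\<close>)
  have exp_int: "integrable N (\<lambda>p. exp (c \<bullet> X p + z \<bullet> Y p))" for c z
  proof (rule integrable_const_bound[where B="exp (norm c * \<bar>K\<bar> + norm z * \<bar>K\<bar>)"])
    show "AE p in N. norm (exp (c \<bullet> X p + z \<bullet> Y p)) \<le> exp (norm c * \<bar>K\<bar> + norm z * \<bar>K\<bar>)"
      using bdd
    proof eventually_elim
      case (elim p)
      have "c \<bullet> X p \<le> norm c * norm (X p)" "z \<bullet> Y p \<le> norm z * norm (Y p)"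
        by (rule norm_cauchy_schwarz)+
      moreover have "norm c * norm (X p) \<le> norm c * \<bar>K\<bar>" "norm z * norm (Y p) \<le> norm z * \<bar>K\<bar>"
        using elim by (auto intro!: mult_left_mono)
      ultimately show ?case by simp
    qed
  qed measurable
  have expX_int: "integrable N (\<lambda>p. exp (c \<bullet> X p + z \<bullet> Y p) *\<^sub>R X p)" for c z
  proof (rule Bochner_Integration.integrable_bound[OF integrable_mult_right[OF exp_int[of c z], of K]])
    show "AE p in N. norm (exp (c \<bullet> X p + z \<bullet> Y p) *\<^sub>R X p) \<le> norm (K * exp (c \<bullet> X p + z \<bullet> Y p))"
      using bdd
    proof eventually_elim
      case (elim p)
      then have "norm (X p) \<le> \<bar>K\<bar>" by linarith
      then show ?case by (simp add: abs_mult mult.commute mult_right_mono)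
    qed
  qed measurable
  have meanX: "(\<integral>p. X p $ j \<partial>N) = 0" for j
  proof -
    have iX: "integrable N X" using expX_int[of 0 0] by simp
    have "(\<integral>p. X p \<partial>N) = 0" using crit[of 0] by (simp add: \<delta>0)
    then show ?thesis
      using integral_inner_left[OF iX, of "axis j 1"] by (simp add: inner_axis)
  qed
  have mean: "(\<integral>p. \<beta> j p \<partial>N) = 0" for j
    unfolding \<beta>eq using intX by (simp add: meanX)
  have dual: "(\<integral>p. \<beta> j p * X p $ k \<partial>N) = (if j = k then 1 else 0)" for j k
  proof -
    have "(\<integral>p. \<beta> j p * X p $ k \<partial>N) = (\<integral>p. (\<Sum>l\<in>UNIV. A $ j $ l * (X p $ l * X p $ k)) \<partial>N)"
      unfolding \<beta>eq by (simp add: sum_distrib_left sum_distrib_right mult_ac)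
    also have "\<dots> = (\<Sum>l\<in>UNIV. A $ j $ l * H $ l $ k)"
      using intXX by (simp add: H_def)
    also have "\<dots> = (A ** H) $ j $ k" by (simp add: matrix_matrix_mult_def)
    finally show ?thesis by (simp add: A mat_def)
  qed
  \<comment> \<open>Chosen so that all exponents are at most \<open>1 / 6\<close>.\<close>
  define \<rho>0 where "\<rho>0 = 1 / (6 * (real CARD('i) + real DIM('a)) * K')"
  have CD: "real CARD('i) + real DIM('a) > 0" by (simp add: add_pos_nonneg)
  have \<rho>0: "\<rho>0 > 0" unfolding \<rho>0_def using K' CD by simp
  have \<rho>0K: "real CARD('i) * K' * \<rho>0 + real DIM('a) * K' * \<rho>0 = 1 / 6"
  proof -
    have cancel: "S * K' * (1 / (6 * S * K')) = 1 / 6" if "S > 0" for S :: real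
      using that K'(1) by simp
    have "real CARD('i) * K' * \<rho>0 + real DIM('a) * K' * \<rho>0 = (real CARD('i) + real DIM('a)) * K' * \<rho>0"
      by (simp add: algebra_simps)
    also have "\<dots> = 1 / 6" unfolding \<rho>0_def by (rule cancel[OF CD])
    finally show ?thesis .
  qed
  let ?X = "\<lambda>j p. X p $ j" and ?Y = "\<lambda>b p. Y p \<bullet> b"
  have "\<exists>r>0. r \<le> \<rho>0 \<and> (\<exists>V. (\<forall>j. sep_holomorphic Basis r (\<lambda>w. V w j)) \<and>
     (\<forall>w\<in>polydisc Basis r. \<forall>j. norm (V w j) \<le> \<rho>0 \<and>
        (\<integral>p. of_real (\<beta> j p) * exp (lin_exponent ?X ?Y (V w) w p) \<partial>N) = 0) \<and>
     (\<forall>z. complexify z \<in> polydisc Basis r \<longrightarrow> (\<forall>j. V (complexify z) j \<in> \<real>)))"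
    by (rule implicit_holomorphic_solution[OF N(1) compm \<beta>m _ K'(1) bound mean dual \<rho>0]) measurable
  then obtain r V where r: "0 < r" "r \<le> \<rho>0"
    and Vhol: "\<And>j. sep_holomorphic Basis r (\<lambda>w. V w j)"
    and Vbd: "\<And>w j. w \<in> polydisc Basis r \<Longrightarrow> norm (V w j) \<le> \<rho>0"
    and Veq: "\<And>w j. w \<in> polydisc Basis r \<Longrightarrow>
        (\<integral>p. of_real (\<beta> j p) * exp (lin_exponent ?X ?Y (V w) w p) \<partial>N) = 0"
    and Vreal: "\<And>z j. complexify z \<in> polydisc Basis r \<Longrightarrow> V (complexify z) j \<in> \<real>"
    by blast
  have V\<delta>: "V (complexify z) j = complex_of_real (\<delta> z $ j)" if z: "complexify z \<in> polydisc Basis r" for z j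
  proof -
    define v :: "real ^ 'i" where "v = (\<chi> j. Re (V (complexify z) j))"
    have Vv: "V (complexify z) j = complex_of_real (v $ j)" for j
      using Vreal[OF z] by (simp add: v_def)
    let ?e = "\<lambda>c p. exp (c \<bullet> X p + z \<bullet> Y p)"
    have "lin_exponent ?X ?Y (V (complexify z)) (complexify z) p = complex_of_real (v \<bullet> X p + z \<bullet> Y p)" for p
      by (simp add: lin_exponent_def Vv complexify_Basis inner_vec_def euclidean_inner[of z "Y p"])
    then have "(\<integral>p. complex_of_real (\<beta> j p * ?e v p) \<partial>N) = 0" for j
      using Veq[OF z, of j] by (simp add: exp_of_real flip: of_real_add)
    then have \<beta>0: "(\<integral>p. \<beta> j p * ?e v p \<partial>N) = 0" for j
      by (simp only: integral_complex_of_real of_real_eq_0_iff)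
    have \<beta>int: "integrable N (\<lambda>p. \<beta> j p * ?e v p)" for j
    proof (rule Bochner_Integration.integrable_bound[OF integrable_mult_right[OF exp_int[of v z], of K']])
      show "AE p in N. norm (\<beta> j p * ?e v p) \<le> norm (K' * ?e v p)"
        using bound
      proof eventually_elim
        case (elim p)
        then have "\<bar>\<beta> j p\<bar> \<le> \<bar>K'\<bar>" using abs_ge_self order_trans by blast
        then show ?case by (simp add: abs_mult mult_right_mono)
      qed
    qed measurable
    have v0: "(\<integral>p. c \<bullet> X p * ?e v p \<partial>N) = 0" for c
    proof -
      have "c \<bullet> X p = (\<Sum>j\<in>UNIV. (c v* H) $ j * \<beta> j p)" for p
      proof -
        have "X p = H *v (A *v X p)" by (simp add: matrix_vector_mul_assoc HA)
        then have "c \<bullet> X p = (c v* H) \<bullet> (A *v X p)" by (metis dot_lmul_matrix)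
        then show ?thesis by (simp add: inner_vec_def \<beta>_def)
      qed
      then have "(\<integral>p. c \<bullet> X p * ?e v p \<partial>N) = (\<integral>p. (\<Sum>j\<in>UNIV. (c v* H) $ j * (\<beta> j p * ?e v p)) \<partial>N)"
        by (simp add: sum_distrib_right mult.assoc)
      also have "\<dots> = 0" using \<beta>int by (simp add: \<beta>0)
      finally show ?thesis .
    qed
    have \<delta>z: "(\<integral>p. c \<bullet> X p * ?e (\<delta> z) p \<partial>N) = 0" for c
      using integral_inner_right[OF expX_int[of "\<delta> z" z], of c] by (simp add: crit mult.commute)
    have int1: "integrable N (\<lambda>p. c \<bullet> X p * ?e c' p)" for c c'
      using integrable_inner_right[OF expX_int[of c' z], of c] by (simp add: mult.commute)
    \<comment> \<open>Strict monotonicity of \<open>exp\<close>: both \<open>v\<close> and \<open>\<delta> z\<close> are critical, so the integral of the nonnegative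
      function \<open>?D\<close> vanishes.\<close>
    let ?D = "\<lambda>p. (v - \<delta> z) \<bullet> X p * (?e v p - ?e (\<delta> z) p)"
    have Dint: "integrable N ?D"
      using int1[of "v - \<delta> z" v] int1[of "v - \<delta> z" "\<delta> z"] by (simp add: right_diff_distrib)
    have "(\<integral>p. ?D p \<partial>N) = 0"
      using int1[of "v - \<delta> z" v] int1[of "v - \<delta> z" "\<delta> z"] v0[of "v - \<delta> z"] \<delta>z[of "v - \<delta> z"]
      by (simp add: right_diff_distrib)
    moreover have mono: "(s - t) * (exp (s + a) - exp (t + a)) \<ge> 0" for s t a :: real
      by (cases "s \<le> t") (auto intro: mult_nonpos_nonpos)
    ultimately have "AE p in N. ?D p = 0"
      using integral_nonneg_eq_0_iff_AE[OF Dint] mono by (simp add: inner_diff_left)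
    then have "AE p in N. (v - \<delta> z) \<bullet> X p = 0"
      by eventually_elim (auto simp: inner_diff_left)
    then have "v - \<delta> z = 0" by (rule nondeg)
    then show ?thesis by (simp add: Vv)
  qed
  show "holomorphically_extends_at (\<lambda>z. \<delta> z $ i) 0"
    by (rule holomorphically_extends_atI[OF r(1) Vhol Vbd]) (simp_all add: V\<delta>)
  show "holomorphically_extends_at (\<lambda>z. ln (\<integral>p. exp (\<delta> z \<bullet> X p + z \<bullet> Y p) \<partial>N)) 0"
  proof (rule holomorphically_extends_at_log_integral_exp[where T="\<lambda>z p. \<delta> z \<bullet> X p + z \<bullet> Y p", OF N r(1)])
    show "sep_holomorphic Basis r (\<lambda>w. lin_exponent ?X ?Y (V w) w p)" for p
      by (rule sep_holomorphic_lin_exponent) (rule Vhol)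
    show "lin_exponent ?X ?Y (V w) w \<in> borel_measurable N" for w
      by (rule lin_exponent_measurable) auto
    show "AE p in N. \<forall>w\<in>polydisc Basis r. norm (lin_exponent ?X ?Y (V w) w p) \<le> 1 / 6"
      using bound
    proof eventually_elim
      case (elim p)
      show ?case
      proof
        fix w :: "'a \<Rightarrow> complex" assume w: "w \<in> polydisc Basis r"
        then have "norm (w b) \<le> \<rho>0" if "b \<in> Basis" for b
          using that r(2) by (force simp add: polydisc_def)
        then have "norm (lin_exponent ?X ?Y (V w) w p) \<le> real CARD('i) * K' * \<rho>0 + real DIM('a) * K' * \<rho>0"
          by (intro norm_lin_exponent_le) (use elim Vbd[OF w] in auto)
        then show "norm (lin_exponent ?X ?Y (V w) w p) \<le> 1 / 6" using \<rho>0K by simp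
      qed
    qed
    show "lin_exponent ?X ?Y (V (complexify z)) (complexify z) p = complex_of_real (\<delta> z \<bullet> X p + z \<bullet> Y p)"
      if "complexify z \<in> polydisc Basis r" for z p
      by (simp add: lin_exponent_def V\<delta>[OF that] complexify_Basis inner_vec_def euclidean_inner[of z "Y p"])
  qed simp
qed

section \<open>Regularity of the dual potentials\<close>

lemma cost_add: "cost (u + z) y = cost u y + ((norm (u + z))\<^sup>2 - (norm u)\<^sup>2) / 2 - z \<bullet> y"
  by (simp add: cost_def power2_norm_eq_inner inner_simps inner_commute field_simps)

lemma cost_add_right: "cost u (y + z) = cost u y + ((norm (y + z))\<^sup>2 - (norm y)\<^sup>2) / 2 - z \<bullet> u"
  using cost_add[of y z u] by (simp add: cost_def norm_minus_commute)

lemma cost_measurable [measurable]: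
  "cost u \<in> borel_measurable borel" "(\<lambda>u. cost u y) \<in> borel_measurable borel"
  unfolding cost_def[abs_def] by measurable

lemma holomorphically_extends_at_sum_coordinate_sq:
  fixes e :: "'i \<Rightarrow> 'a::euclidean_space"
  assumes "finite I" "\<And>i. i \<in> I \<Longrightarrow> e i \<in> Basis"
  shows "holomorphically_extends_at (\<lambda>z. (\<Sum>i\<in>I. (z \<bullet> e i)\<^sup>2)) a"
  unfolding power2_eq_square
  by (intro holomorphically_extends_at_sum holomorphically_extends_at_mult
      holomorphically_extends_at_inner assms)

lemma norm_sq_eq_sum: "(norm (x :: 'a::euclidean_space))\<^sup>2 = (\<Sum>b\<in>Basis. (x \<bullet> b)\<^sup>2)"
  unfolding power2_norm_eq_inner by (subst euclidean_inner) (simp add: power2_eq_square)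

text \<open>The shape that the equations give to both \<open>f\<close> and \<open>h\<close>: a quadratic polynomial minus \<open>\<epsilon>\<close> times the
  logarithm of an exponential integral.\<close>

lemma holomorphically_extends_at_log_form:
  assumes \<phi>: "\<And>u. \<phi> u = (q u - c) / 2 - \<epsilon> * ln (Z (u - a))"
    and q: "holomorphically_extends_at q a"
    and Z: "holomorphically_extends_at (\<lambda>z. ln (Z z)) 0"
  shows "holomorphically_extends_at \<phi> a"
proof -
  have "holomorphically_extends_at (\<lambda>u. (- c / 2 + 1 / 2 * q u) + - \<epsilon> * ln (Z (u - a))) a"
    using Z by (intro holomorphically_extends_at_add holomorphically_extends_at_mult
        holomorphically_extends_at_const q)
      (subst holomorphically_extends_at_shift)
  then show ?thesis by (simp add: \<phi>[abs_def] diff_divide_distrib algebra_simps)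
qed

theorem theorem2p2:
  fixes M :: "'w measure"
    and X :: "'w \<Rightarrow> real ^ 'dx" and Y :: "'w \<Rightarrow> real ^ 'dy"
    and \<mu> :: "(real ^ 'dy) measure" and \<nu> :: "((real ^ 'dx) \<times> (real ^ 'dy)) measure"
    and \<epsilon> :: real
    and f :: "real ^ 'dy \<Rightarrow> real" and g :: "real ^ 'dy \<Rightarrow> real ^ 'dx"
    and h :: "(real ^ 'dx) \<times> (real ^ 'dy) \<Rightarrow> real"
  assumes "prob_space M" and "X \<in> borel_measurable M" and "Y \<in> borel_measurable M"
    and "\<nu> = distr M borel (\<lambda>\<omega>. (X \<omega>, Y \<omega>))"
    and "integrable M X" and "(\<integral>\<omega>. X \<omega> \<partial>M) = 0"
    and "prob_space \<mu>" and "sets \<mu> = sets borel"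
    and "\<epsilon> > 0"
    and "invertible (\<chi> i j. \<integral>\<omega>. X \<omega> $ i * X \<omega> $ j \<partial>M)"
    and "compact (measure_support \<mu>)"
    and "compact (measure_support (distr M borel X))"
    and "compact (measure_support (distr M borel Y))"
    and "dual_potentials \<epsilon> \<mu> \<nu> f g h"
    and "\<And>u. integrable \<nu> (\<lambda>(x, y). exp (1 / \<epsilon> * (g u \<bullet> x + h (x, y) - cost u y)))"
    and "\<And>u. f u = - \<epsilon> * ln (\<integral>(x, y). exp (1 / \<epsilon> * (g u \<bullet> x + h (x, y) - cost u y)) \<partial>\<nu>)"
    and "\<And>u. integrable \<nu> (\<lambda>(x, y). exp (1 / \<epsilon> * (g u \<bullet> x + h (x, y) - cost u y)) *\<^sub>R x)"
    and "\<And>u. (\<integral>(x, y). exp (1 / \<epsilon> * (g u \<bullet> x + h (x, y) - cost u y)) *\<^sub>R x \<partial>\<nu>) = 0"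
    and "\<And>x y. integrable \<mu> (\<lambda>u. exp (1 / \<epsilon> * (f u + g u \<bullet> x - cost u y)))"
    and "\<And>x y. h (x, y) = - \<epsilon> * ln (\<integral>u. exp (1 / \<epsilon> * (f u + g u \<bullet> x - cost u y)) \<partial>\<mu>)"
  shows "(real_analytic f \<and> (\<forall>i. real_analytic (\<lambda>u. g u $ i))) \<and> real_analytic h"
proof -
  note X [measurable] = assms(2) and Y [measurable] = assms(3)
    and \<nu>_def = assms(4) and sets_\<mu> [measurable_cong] = assms(8) and \<epsilon> = assms(9)
  interpret M: prob_space M by fact
  interpret \<mu>: prob_space \<mu> by fact
  have XY [measurable]: "(\<lambda>\<omega>. (X \<omega>, Y \<omega>)) \<in> borel_measurable M" by measurable
  have sets_\<nu> [measurable_cong]: "sets \<nu> = sets borel" by (simp add: \<nu>_def)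
  interpret \<nu>: prob_space \<nu> unfolding \<nu>_def by (rule M.prob_space_distr) measurable
  have "integrable \<mu> f" "integrable \<mu> g" "integrable \<nu> h"
    using assms(14) by (auto simp: dual_potentials_def L1_triples_def)
  then have [measurable]: "f \<in> borel_measurable \<mu>" "g \<in> borel_measurable \<mu>" "h \<in> borel_measurable \<nu>"
    by (auto simp: borel_measurable_integrable)
  have [measurable]: "fst \<in> borel_measurable \<nu>" "snd \<in> borel_measurable \<nu>"
    unfolding measurable_cong_sets[OF sets_\<nu> refl]
    by (intro borel_measurable_continuous_onI continuous_intros)+
  obtain BX where BX: "AE \<omega> in M. norm (X \<omega>) \<le> BX"
    using AE_norm_bounded_if_compact_support[OF X assms(12)] by blast
  obtain BY where BY: "AE \<omega> in M. norm (Y \<omega>) \<le> BY"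
    using AE_norm_bounded_if_compact_support[OF Y assms(13)] by blast
  define K where "K = (\<bar>BX\<bar> + \<bar>BY\<bar>) / \<epsilon>"
  have AE_\<nu>: "AE p in \<nu>. norm (fst p /\<^sub>R \<epsilon>) \<le> K \<and> norm (snd p /\<^sub>R \<epsilon>) \<le> K"
    unfolding \<nu>_def
  proof (subst AE_distr_iff[OF XY])
    show "AE \<omega> in M. norm (fst (X \<omega>, Y \<omega>) /\<^sub>R \<epsilon>) \<le> K \<and> norm (snd (X \<omega>, Y \<omega>) /\<^sub>R \<epsilon>) \<le> K"
      using BX BY by eventually_elim (use \<epsilon> in \<open>auto simp: K_def field_simps\<close>)
  qed (auto intro!: borel_closed closed_Collect_conj closed_Collect_le continuous_intros)
  have XXint: "integrable M (\<lambda>\<omega>. X \<omega> $ i * X \<omega> $ j)" for i j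
  proof -
    have [measurable]: "(\<lambda>\<omega>. X \<omega> $ k) \<in> borel_measurable M" for k
    proof -
      have "(\<lambda>\<omega>. X \<omega> \<bullet> axis k 1) \<in> borel_measurable M" by measurable
      then show ?thesis by (simp add: inner_axis)
    qed
    show ?thesis
    proof (rule M.integrable_const_bound[where B="\<bar>BX\<bar> * \<bar>BX\<bar>"])
      show "AE \<omega> in M. norm (X \<omega> $ i * X \<omega> $ j) \<le> \<bar>BX\<bar> * \<bar>BX\<bar>"
        using BX
      proof eventually_elim
        case (elim \<omega>)
        have "\<bar>X \<omega> $ k\<bar> \<le> \<bar>BX\<bar>" for k
          using component_le_norm_cart[of "X \<omega>" k] elim by linarith
        note le = this
        show ?case unfolding real_norm_def abs_mult by (rule mult_mono) (use le in auto)
      qed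
    qed measurable
  qed
  have nondeg: "c = 0" if c: "AE p in \<nu>. c \<bullet> (fst p /\<^sub>R \<epsilon>) = 0" for c
  proof -
    have "AE \<omega> in M. c \<bullet> (fst (X \<omega>, Y \<omega>) /\<^sub>R \<epsilon>) = 0"
      using c unfolding \<nu>_def
      by (subst (asm) AE_distr_iff[OF XY]) (auto intro!: borel_closed closed_Collect_eq continuous_intros)
    then have "AE \<omega> in M. X \<omega> \<bullet> c = 0"
      by eventually_elim (use \<epsilon> in \<open>simp add: inner_commute\<close>)
    then have cX: "AE \<omega> in M. (\<Sum>j\<in>UNIV. X \<omega> $ j * c $ j) = 0"
      by (simp add: inner_vec_def)
    have "(\<chi> i j. \<integral>\<omega>. X \<omega> $ i * X \<omega> $ j \<partial>M) *v c = 0"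
    proof (rule vec_eq_iff[THEN iffD2], rule allI)
      fix i
      have "((\<chi> i j. \<integral>\<omega>. X \<omega> $ i * X \<omega> $ j \<partial>M) *v c) $ i =
          (\<Sum>j\<in>UNIV. (\<integral>\<omega>. X \<omega> $ i * X \<omega> $ j * c $ j \<partial>M))"
        by (simp add: matrix_vector_mult_def)
      also have "\<dots> = (\<integral>\<omega>. (\<Sum>j\<in>UNIV. X \<omega> $ i * X \<omega> $ j * c $ j) \<partial>M)"
        by (rule Bochner_Integration.integral_sum[symmetric]) (intro integrable_mult_left XXint)
      also have "\<dots> = (\<integral>\<omega>. 0 \<partial>M)"
      proof (rule integral_cong_AE)
        show "AE \<omega> in M. (\<Sum>j\<in>UNIV. X \<omega> $ i * X \<omega> $ j * c $ j) = 0"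
          using cX by eventually_elim (simp add: mult.assoc flip: sum_distrib_left)
      qed (use XXint in \<open>auto intro!: borel_measurable_sum borel_measurable_integrable\<close>)
      finally show "((\<chi> i j. \<integral>\<omega>. X \<omega> $ i * X \<omega> $ j \<partial>M) *v c) $ i = 0 $ i" by simp
    qed
    then show ?thesis
      using assms(10) matrix_left_invertible_ker[of "\<chi> i j. \<integral>\<omega>. X \<omega> $ i * X \<omega> $ j \<partial>M"]
      by (auto simp: invertible_def)
  qed
  \<comment> \<open>The potentials \<open>f\<close> and \<open>g\<close>, with \<open>N\<close> the measure \<open>\<nu>\<close> tilted by the exponent at \<open>u0\<close>.\<close>
  have fg: "holomorphically_extends_at f u0 \<and> (\<forall>i. holomorphically_extends_at (\<lambda>u. g u $ i) u0)" for u0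
  proof -
    define w where "w p = 1 / \<epsilon> * (g u0 \<bullet> fst p + h p - cost u0 (snd p))" for p
    have wm [measurable]: "w \<in> borel_measurable \<nu>"
      unfolding w_def[abs_def] by measurable
    have wint: "integrable \<nu> (\<lambda>p. exp (w p))"
      using assms(15)[of u0] by (simp add: w_def case_prod_unfold)
    define N where "N = density \<nu> (\<lambda>p. ennreal (exp (w p)))"
    note N = \<nu>.exp_tilted_measure[OF wm wint, folded N_def]
    have N_AE: "(AE p in N. Q p) \<longleftrightarrow> (AE p in \<nu>. Q p)" for Q
      unfolding N_def by (rule AE_exp_tilted[OF wm])
    have [measurable_cong]: "sets N = sets \<nu>" by (simp add: N_def)
    define \<delta> where "\<delta> z = g (u0 + z) - g u0" for z
    define e where "e z p = \<delta> z \<bullet> (fst p /\<^sub>R \<epsilon>) + z \<bullet> (snd p /\<^sub>R \<epsilon>)" for z p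
    define q where "q z = ((norm (u0 + z))\<^sup>2 - (norm u0)\<^sup>2) / 2" for z
    have split: "exp (1 / \<epsilon> * (g (u0 + z) \<bullet> fst p + h p - cost (u0 + z) (snd p))) =
        exp (- q z / \<epsilon>) * (exp (w p) * exp (e z p))" for z p
    proof -
      have "1 / \<epsilon> * (g (u0 + z) \<bullet> fst p + h p - cost (u0 + z) (snd p)) = - q z / \<epsilon> + (w p + e z p)"
        using \<epsilon> by (simp add: cost_add w_def e_def \<delta>_def q_def inner_diff_left field_simps)
      then show ?thesis by (simp only: exp_add)
    qed
    have em [measurable]: "e z \<in> borel_measurable \<nu>" for z
      unfolding e_def[abs_def] by measurable
    define Z where "Z z = (\<integral>p. exp (e z p) \<partial>N)" for z
    have tot: "(\<integral>(x, y). exp (1 / \<epsilon> * (g (u0 + z) \<bullet> x + h (x, y) - cost (u0 + z) y)) \<partial>\<nu>) =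
        exp (- q z / \<epsilon>) * Z z" for z
    proof -
      have "(\<integral>(x, y). exp (1 / \<epsilon> * (g (u0 + z) \<bullet> x + h (x, y) - cost (u0 + z) y)) \<partial>\<nu>) =
          (\<integral>p. exp (- q z / \<epsilon>) * (exp (w p) * exp (e z p)) \<partial>\<nu>)"
        using split by (simp add: case_prod_unfold)
      also have "\<dots> = exp (- q z / \<epsilon>) * (\<integral>p. exp (w p) * exp (e z p) \<partial>\<nu>)" by simp
      also have "(\<integral>p. exp (w p) * exp (e z p) \<partial>\<nu>) = Z z"
        unfolding Z_def N_def by (subst integral_exp_tilted[OF wm]) auto
      finally show ?thesis .
    qed
    have Zpos: "Z z > 0" for z
    proof -
      have "(\<integral>(x, y). exp (1 / \<epsilon> * (g (u0 + z) \<bullet> x + h (x, y) - cost (u0 + z) y)) \<partial>\<nu>) > 0"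
        unfolding case_prod_unfold
        using assms(15)[of "u0 + z"] by (intro \<nu>.integral_exp_pos) (simp add: case_prod_unfold)
      then show ?thesis unfolding tot by (simp add: zero_less_mult_iff)
    qed
    have fZ: "f u = ((norm u)\<^sup>2 - (norm u0)\<^sup>2) / 2 - \<epsilon> * ln (Z (u - u0))" for u
    proof -
      have "f (u0 + z) = q z - \<epsilon> * ln (Z z)" for z
        unfolding assms(16)[of "u0 + z"] tot using Zpos[of z] \<epsilon> by (simp add: ln_mult field_simps)
      from this[of "u - u0"] show ?thesis by (simp add: q_def)
    qed
    have crit: "(\<integral>p. exp (e z p) *\<^sub>R (fst p /\<^sub>R \<epsilon>) \<partial>N) = 0" for z
    proof -
      have "(\<integral>p. exp (1 / \<epsilon> * (g (u0 + z) \<bullet> fst p + h p - cost (u0 + z) (snd p))) *\<^sub>R fst p \<partial>\<nu>) = 0"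
        using assms(18)[of "u0 + z"] by (simp only: case_prod_unfold prod.collapse)
      then have "exp (- q z / \<epsilon>) *\<^sub>R (\<integral>p. exp (w p) *\<^sub>R exp (e z p) *\<^sub>R fst p \<partial>\<nu>) = 0"
        unfolding split scaleR_scaleR[symmetric] integral_scaleR_right .
      then have zero: "(\<integral>p. exp (w p) *\<^sub>R exp (e z p) *\<^sub>R fst p \<partial>\<nu>) = 0" by simp
      have "(\<integral>p. exp (e z p) *\<^sub>R (fst p /\<^sub>R \<epsilon>) \<partial>N) = (\<integral>p. exp (w p) *\<^sub>R exp (e z p) *\<^sub>R (fst p /\<^sub>R \<epsilon>) \<partial>\<nu>)"
        unfolding N_def by (rule integral_exp_tilted[OF wm]) measurable
      also have "\<dots> = (\<integral>p. inverse \<epsilon> *\<^sub>R (exp (w p) *\<^sub>R exp (e z p) *\<^sub>R fst p) \<partial>\<nu>)"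
        by (simp only: scaleR_left_commute)
      also have "\<dots> = inverse \<epsilon> *\<^sub>R 0"
        unfolding integral_scaleR_right zero ..
      finally show ?thesis by simp
    qed
    have m: "(\<lambda>p. fst p /\<^sub>R \<epsilon>) \<in> borel_measurable N" "(\<lambda>p. snd p /\<^sub>R \<epsilon>) \<in> borel_measurable N"
      by measurable
    have N_nondeg: "c = 0" if "AE p in N. c \<bullet> (fst p /\<^sub>R \<epsilon>) = 0" for c
      using that unfolding N_AE by (rule nondeg)
    have \<delta>0: "\<delta> 0 = 0" by (simp add: \<delta>_def)
    note main = tilted_critical_point_holomorphic[OF N m AE_\<nu>[folded N_AE] N_nondeg \<delta>0
        crit[unfolded e_def], folded e_def, folded Z_def]
    have "holomorphically_extends_at f u0"
      by (rule holomorphically_extends_at_log_form[OF fZ _ main(2)])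
         (auto simp: norm_sq_eq_sum intro!: holomorphically_extends_at_sum_coordinate_sq)
    moreover have "holomorphically_extends_at (\<lambda>u. g u $ i) u0" for i
    proof -
      have "holomorphically_extends_at (\<lambda>u. \<delta> (u - u0) $ i + g u0 $ i) u0"
        by (intro holomorphically_extends_at_add holomorphically_extends_at_const)
           (subst holomorphically_extends_at_shift[of "\<lambda>z. \<delta> z $ i"], rule main(1))
      then show ?thesis by (simp add: \<delta>_def)
    qed
    ultimately show ?thesis by blast
  qed
  \<comment> \<open>\<open>g\<close> is locally bounded, hence bounded on the compact support of \<open>\<mu>\<close>.\<close>
  have "\<exists>B. \<forall>u\<in>measure_support \<mu>. \<bar>g u $ i\<bar> \<le> B" for i
    by (rule compact_bounded_if_locally_bounded[OF assms(11)])
       (use fg holomorphically_extends_at_locally_bounded in blast)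
  then obtain B where B: "\<And>i u. u \<in> measure_support \<mu> \<Longrightarrow> \<bar>g u $ i\<bar> \<le> B i" by metis
  obtain B0 where B0: "\<And>u. u \<in> measure_support \<mu> \<Longrightarrow> norm u \<le> B0"
    using compact_imp_bounded[OF assms(11)] unfolding bounded_iff by blast
  define P where "P u = (g u, u) /\<^sub>R \<epsilon>" for u
  have P_AE: "AE u in \<mu>. norm (P u) \<le> ((\<Sum>i\<in>UNIV. B i) + B0) / \<epsilon>"
    using AE_in_measure_support[OF sets_\<mu>]
  proof eventually_elim
    case (elim u)
    have "norm (g u, u) \<le> norm (g u) + norm u" by (rule norm_Pair_le)
    also have "norm (g u) \<le> (\<Sum>i\<in>UNIV. \<bar>g u $ i\<bar>)" by (rule norm_le_l1_cart)
    also have "\<dots> \<le> (\<Sum>i\<in>UNIV. B i)" by (intro sum_mono B elim)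
    finally have "norm (g u, u) \<le> (\<Sum>i\<in>UNIV. B i) + B0" using B0[OF elim] by simp
    then show ?case unfolding P_def norm_scaleR using \<epsilon> by (simp add: divide_simps)
  qed
  \<comment> \<open>The potential \<open>h\<close>, with \<open>N\<close> the measure \<open>\<mu>\<close> tilted by the exponent at \<open>q0\<close>; the variable \<open>z\<close> now pairs
    with the bounded vector \<open>(g u, u) / \<epsilon>\<close>.\<close>
  have hh: "holomorphically_extends_at h q0" for q0
  proof -
    obtain x0 y0 where q0: "q0 = (x0, y0)" by (cases q0)
    define w where "w u = 1 / \<epsilon> * (f u + g u \<bullet> x0 - cost u y0)" for u
    have wm [measurable]: "w \<in> borel_measurable \<mu>"
      unfolding w_def[abs_def] by measurable
    have wint: "integrable \<mu> (\<lambda>u. exp (w u))"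
      using assms(19)[of x0 y0] by (simp add: w_def)
    define N where "N = density \<mu> (\<lambda>u. ennreal (exp (w u)))"
    note N = \<mu>.exp_tilted_measure[OF wm wint, folded N_def]
    have N_AE: "(AE p in N. Q p) \<longleftrightarrow> (AE p in \<mu>. Q p)" for Q
      unfolding N_def by (rule AE_exp_tilted[OF wm])
    have Pm [measurable]: "P \<in> borel_measurable \<mu>"
      unfolding P_def[abs_def] by measurable
    define q where "q z = ((norm (y0 + snd z))\<^sup>2 - (norm y0)\<^sup>2) / 2" for z :: "(real ^ 'dx) \<times> (real ^ 'dy)"
    have split: "exp (1 / \<epsilon> * (f u + g u \<bullet> (x0 + fst z) - cost u (y0 + snd z))) =
        exp (- q z / \<epsilon>) * (exp (w u) * exp (z \<bullet> P u))" for z u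
    proof -
      have "z \<bullet> P u = 1 / \<epsilon> * (g u \<bullet> fst z + snd z \<bullet> u)"
        by (cases z) (simp add: P_def inner_commute divide_inverse algebra_simps)
      then have "1 / \<epsilon> * (f u + g u \<bullet> (x0 + fst z) - cost u (y0 + snd z)) = - q z / \<epsilon> + (w u + z \<bullet> P u)"
        using \<epsilon> by (simp add: cost_add_right w_def q_def inner_add_right field_simps)
      then show ?thesis by (simp only: exp_add)
    qed
    define Z where "Z z = (\<integral>u. exp (z \<bullet> P u) \<partial>N)" for z
    have tot: "(\<integral>u. exp (1 / \<epsilon> * (f u + g u \<bullet> (x0 + fst z) - cost u (y0 + snd z))) \<partial>\<mu>) =
        exp (- q z / \<epsilon>) * Z z" for z
    proof -
      have "(\<integral>u. exp (w u) * exp (z \<bullet> P u) \<partial>\<mu>) = Z z"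
        unfolding Z_def N_def by (subst integral_exp_tilted[OF wm]) auto
      then show ?thesis unfolding split by simp
    qed
    have Zpos: "Z z > 0" for z
      using \<mu>.integral_exp_pos[OF assms(19)[of "x0 + fst z" "y0 + snd z"]]
      unfolding tot by (simp add: zero_less_mult_iff)
    have hZ: "h p = ((norm (snd p))\<^sup>2 - (norm y0)\<^sup>2) / 2 - \<epsilon> * ln (Z (p - q0))" for p
    proof -
      have "h (x0 + fst z, y0 + snd z) = q z - \<epsilon> * ln (Z z)" for z
        unfolding assms(20) tot using Zpos[of z] \<epsilon> by (simp add: ln_mult field_simps)
      from this[of "p - q0"] show ?thesis by (simp add: q_def q0)
    qed
    have "holomorphically_extends_at (\<lambda>z. ln (Z z)) 0"
      unfolding Z_def
      by (rule holomorphically_extends_at_log_laplace[OF N]) (use P_AE in \<open>auto simp: N_AE N_def\<close>)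
    moreover have "holomorphically_extends_at (\<lambda>p::(real ^ 'dx) \<times> (real ^ 'dy). (norm (snd p))\<^sup>2) q0"
    proof -
      have "(norm (snd p))\<^sup>2 = (\<Sum>b\<in>Basis. (p \<bullet> (0, b))\<^sup>2)" for p :: "(real ^ 'dx) \<times> (real ^ 'dy)"
        by (cases p) (simp add: norm_sq_eq_sum)
      then show ?thesis
        by (auto simp: Basis_prod_def intro!: holomorphically_extends_at_sum_coordinate_sq)
    qed
    ultimately show ?thesis
      by (intro holomorphically_extends_at_log_form[where q="\<lambda>p. (norm (snd p))\<^sup>2" and Z=Z, OF hZ])
  qed
  show ?thesis
    using fg hh by (auto intro: real_analytic_if_holomorphically_extends)
qed

end
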